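(* Suppose SJA for $m$ items is well-defined. If for every $J\subseteq[m]$ with $U_J\neq\emptyset$ the SIM-body $\Lambda(\lambda_1,\dots,\lambda_{|J|})$ contains no body of positive $1$-deficiency, then SJA is optimal: its expected revenue equals the supremum of expected revenue over all (possibly randomized) IC and IR mechanisms for a single additive buyer with i.i.d. uniform $[0,1]$ values for the $m$ items.
   Context: Mechanisms: allocation $\mathbf a:[0,1]^m\to[0,1]^m$ and payment $p:[0,1]^m\to\mathbb R$; buyer utility for report $\mathbf x'$ and true values $\mathbf x$ is $\mathbf a(\mathbf x')\cdot\mathbf x-p(\mathbf x')$; IC means truthful reporting maximizes utility, IR means truthful utility $\ge 0$; revenue is $\mathbb E[p(\mathbf x)]$. SJA: let $k=1/(m+1)$, $p_0=0$. SJA is the deterministic mechanism selling any bundle of $r$ items at price $p_r$, the buyer taking a bundle maximizing $\sum_{j\in J}x_j-p_{|J|}$. Prices are fixed successively: having fixed $p_1,\dots,p_{r-1}$, $p_r$ is chosen as large as possible with $\Pr_{\mathbf x\sim U[0,1]^r}[\sum_{j\in J}x_j<p_{|J|}\ \forall J\subseteq[r]]=1-rk$; SJA is well-defined if such prices exist. Normalize: for every $j\in[m-1]$ with $p_j\ge p_m$ replace $p_j$ by $p_m$. With normalized prices, $\mu_0=0$, $\mu_r=(m+1)(r-p_r)$, $\lambda_r=\mu_r-\mu_{r-1}$. $U_J=\{\mathbf x\in[0,1]^m:\sum_{j\in J}x_j-p_{|J|}\ge\sum_{j\in L}x_j-p_{|L|}\ \forall L\subseteq[m]\}$. SIM-body: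 for $0<\alpha_1\le\dots\le\alpha_r$, $\Lambda(\alpha_1,\dots,\alpha_r)=\{\mathbf x\in\mathbb R_+^r:\sum_{j\in J}x_j\le\sum_{j=r-|J|+1}^r\alpha_j\ \forall J\subseteq[r]\}$. A body is a compact subset of $\mathbb R_+^r$; its $k$-deficiency is $\delta_k(A)=|A|-k\sum_{j=1}^r|A_{[r]\setminus\{j\}}|$, with $A_{[r]\setminus\{j\}}=\{\mathbf x_{-j}:\mathbf x\in A\}$ and $|\cdot|$ Lebesgue measure in the relevant dimension. *)

theory Defs
  imports "HOL-Analysis.Analysis"
begin

(* Items are indexed by {..<m}; a value profile is an extensional function nat => real. *)

definition cube :: "nat \<Rightarrow> (nat \<Rightarrow> real) set" where
  "cube m = PiE {..<m} (\<lambda>_. {0..1})"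

definition unifM :: "nat \<Rightarrow> (nat \<Rightarrow> real) measure" where
  "unifM r = PiM {..<r} (\<lambda>_. restrict_space lborel {0..1::real})"

definition dotp :: "nat \<Rightarrow> (nat \<Rightarrow> real) \<Rightarrow> (nat \<Rightarrow> real) \<Rightarrow> real" where
  "dotp m y x = (\<Sum>i<m. y i * x i)"

definition is_alloc :: "nat \<Rightarrow> ((nat \<Rightarrow> real) \<Rightarrow> (nat \<Rightarrow> real)) \<Rightarrow> bool" where
  "is_alloc m a \<longleftrightarrow> (\<forall>x\<in>cube m. \<forall>i<m. 0 \<le> a x i \<and> a x i \<le> 1)"

definition is_IC :: "nat \<Rightarrow> ((nat \<Rightarrow> real) \<Rightarrow> (nat \<Rightarrow> real)) \<Rightarrow> ((nat \<Rightarrow> real) \<Rightarrow> real) \<Rightarrow> bool" where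
  "is_IC m a p \<longleftrightarrow> (\<forall>x\<in>cube m. \<forall>x'\<in>cube m. dotp m (a x') x - p x' \<le> dotp m (a x) x - p x)"

definition is_IR :: "nat \<Rightarrow> ((nat \<Rightarrow> real) \<Rightarrow> (nat \<Rightarrow> real)) \<Rightarrow> ((nat \<Rightarrow> real) \<Rightarrow> real) \<Rightarrow> bool" where
  "is_IR m a p \<longleftrightarrow> (\<forall>x\<in>cube m. 0 \<le> dotp m (a x) x - p x)"

definition revenue :: "nat \<Rightarrow> ((nat \<Rightarrow> real) \<Rightarrow> real) \<Rightarrow> real" where
  "revenue m p = integral\<^sup>L (completion (unifM m)) p"

definition opt_revenue :: "nat \<Rightarrow> real" where
  "opt_revenue m = Sup {revenue m p | a p. is_alloc m a \<and> is_IC m a p \<and> is_IR m a p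
       \<and> p \<in> borel_measurable (completion (unifM m))}"

definition sja_prob :: "nat \<Rightarrow> (nat \<Rightarrow> real) \<Rightarrow> real" where
  "sja_prob r q = measure (unifM r)
     {x \<in> space (unifM r). \<forall>J. J \<subseteq> {..<r} \<and> J \<noteq> {} \<longrightarrow> (\<Sum>j\<in>J. x j) < q (card J)}"

definition sja_prices :: "nat \<Rightarrow> (nat \<Rightarrow> real) \<Rightarrow> bool" where
  "sja_prices m p \<longleftrightarrow> p 0 = 0 \<and>
     (\<forall>r\<in>{1..m}. sja_prob r p = 1 - real r / (real m + 1) \<and>
        (\<forall>c. sja_prob r (p(r := c)) = 1 - real r / (real m + 1) \<longrightarrow> c \<le> p r))"

definition norm_prices :: "nat \<Rightarrow> (nat \<Rightarrow> real) \<Rightarrow> nat \<Rightarrow> real" where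
  "norm_prices m p j = (if 1 \<le> j \<and> j < m \<and> p m \<le> p j then p m else p j)"

definition sja_mu :: "nat \<Rightarrow> (nat \<Rightarrow> real) \<Rightarrow> nat \<Rightarrow> real" where
  "sja_mu m p r = (if r = 0 then 0 else (real m + 1) * (real r - norm_prices m p r))"

definition sja_lambda :: "nat \<Rightarrow> (nat \<Rightarrow> real) \<Rightarrow> nat \<Rightarrow> real" where
  "sja_lambda m p r = sja_mu m p r - sja_mu m p (r - 1)"

definition sja_region :: "nat \<Rightarrow> (nat \<Rightarrow> real) \<Rightarrow> nat set \<Rightarrow> (nat \<Rightarrow> real) set" where
  "sja_region m p J = {x \<in> cube m. \<forall>L. L \<subseteq> {..<m} \<longrightarrow>
      (\<Sum>j\<in>L. x j) - norm_prices m p (card L) \<le> (\<Sum>j\<in>J. x j) - norm_prices m p (card J)}"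

(* SIM-body Lambda(alpha_1,...,alpha_r), coordinates indexed by {..<r}, alpha indexed 1..r *)
definition SIM_body :: "nat \<Rightarrow> (nat \<Rightarrow> real) \<Rightarrow> (nat \<Rightarrow> real) set" where
  "SIM_body r \<alpha> = {x \<in> PiE {..<r} (\<lambda>_. {0..}). \<forall>J. J \<subseteq> {..<r} \<longrightarrow>
      (\<Sum>j\<in>J. x j) \<le> (\<Sum>j\<in>{r - card J + 1..r}. \<alpha> j)}"

definition body :: "nat \<Rightarrow> (nat \<Rightarrow> real) set \<Rightarrow> bool" where
  "body r A \<longleftrightarrow> compact A \<and> A \<subseteq> PiE {..<r} (\<lambda>_. {0..})"

definition deficiency :: "real \<Rightarrow> nat \<Rightarrow> (nat \<Rightarrow> real) set \<Rightarrow> real" where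
  "deficiency k r A = measure (PiM {..<r} (\<lambda>_. lborel)) A
     - k * (\<Sum>j<r. measure (PiM ({..<r} - {j}) (\<lambda>_. lborel))
                         ((\<lambda>x. restrict x ({..<r} - {j})) ` A))"

(* (a,pay) is the SJA mechanism with prices p (any tie-breaking) *)
definition sja_implements :: "nat \<Rightarrow> (nat \<Rightarrow> real) \<Rightarrow> ((nat \<Rightarrow> real) \<Rightarrow> (nat \<Rightarrow> real))
    \<Rightarrow> ((nat \<Rightarrow> real) \<Rightarrow> real) \<Rightarrow> bool" where
  "sja_implements m p a pay \<longleftrightarrow> (\<forall>x\<in>cube m. \<exists>J. J \<subseteq> {..<m} \<and>
      (\<forall>L. L \<subseteq> {..<m} \<longrightarrow> (\<Sum>j\<in>L. x j) - p (card L) \<le> (\<Sum>j\<in>J. x j) - p (card J)) \<and>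
      (\<forall>i<m. a x i = (if i \<in> J then 1 else 0)) \<and> pay x = p (card J))"

end

theory Submission
  imports Defs "HOL-Probability.Probability_Measure"
begin

text \<open>
  Let \<open>u\<close> be the truthful utility of an IC mechanism. Integrating by parts along each coordinate, its
  revenue is \<open>\<Sum>\<^sub>j \<integral> u(1, x\<^sub>-\<^sub>j) - (m + 1) \<integral> u\<close>, a functional linear in \<open>u\<close>. Let \<open>u*\<close> be the
  utility under SJA and \<open>w = u* - u\<close>; it has to be shown that \<open>(m + 1) \<integral> w\<close> is at most the sum of
  the integrals of \<open>w\<close> over the faces \<open>x\<^sub>j = 1\<close>.

  On the region \<open>U\<^sub>J\<close> the function \<open>u*\<close> has slope 1 in the directions \<open>j \<in> J\<close>, whereas \<open>u\<close> has slope
  at most 1, so \<open>w\<close> is nondecreasing there. Hence on every section of \<open>U\<^sub>J\<close> in the coordinates \<open>J\<close>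
  the superlevel sets of \<open>w\<close> are up-sets, and the map \<open>y = (m + 1)(1 - x)\<close> turns them into
  down-closed bodies inside the SIM-body, whose projections are their faces. Nonpositive deficiency of
  these bodies, integrated over all levels and sections, gives the claimed inequality on \<open>U\<^sub>J\<close> for
  \<open>w + C \<ge> 0\<close>. The constant \<open>C\<close> drops out because the set \<open>Z\<close> on which nothing is sold has measure
  exactly \<open>1 / (m + 1)\<close>, and \<open>w \<le> 0\<close> on \<open>Z\<close>.
\<close>

section \<open>Uniform measure on cubes\<close>

abbreviation unit_lborel :: "real measure" where
  "unit_lborel \<equiv> restrict_space lborel {0..1}"

text \<open>\<open>cubeM {..<r}\<close> is \<open>unifM r\<close>. Other index sets occur because
  the faces of the cube live on \<open>{..<m} - {j}\<close> and sections split the items into a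
  bundle and its complement.\<close>

abbreviation cubeM :: "nat set \<Rightarrow> (nat \<Rightarrow> real) measure" where
  "cubeM I \<equiv> PiM I (\<lambda>_. unit_lborel)"

lemma prob_space_unit_lborel: "prob_space unit_lborel"
  by (rule prob_spaceI) (simp add: emeasure_restrict_space space_restrict_space)

interpretation unit: prob_space unit_lborel
  by (rule prob_space_unit_lborel)

interpretation cube: product_sigma_finite "\<lambda>_::nat. unit_lborel"
  by standard

interpretation box: product_sigma_finite "\<lambda>_::nat. lborel :: real measure"
  by standard

lemma prob_space_cubeM: "finite I \<Longrightarrow> prob_space (cubeM I)"
  using cube.emeasure_PiM[of I "\<lambda>_. space unit_lborel"] sets.top[of unit_lborel]
  by (intro prob_spaceI) (simp only: space_PiM unit.emeasure_space_1 prod.neutral_const)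

lemma space_cubeM: "space (cubeM I) = PiE I (\<lambda>_. {0..1})"
  by (simp add: space_PiM space_restrict_space)

text \<open>Coordinates in \<open>I\<close> are measurable by construction, and all others are
  constantly \<open>undefined\<close>. Closed sets and continuous functions for the product topology
  on all of \<open>nat \<Rightarrow> real\<close> can therefore be used with every
  \<open>cubeM I\<close>.\<close>

lemma measurable_cubeM_borel [measurable]: "(\<lambda>x. x) \<in> borel_measurable (cubeM I)"
proof (rule measurable_coordinatewise_then_product)
  fix i
  show "(\<lambda>x. x i) \<in> borel_measurable (cubeM I)"
  proof (cases "i \<in> I")
    case True
    have "(\<lambda>x. x i) \<in> measurable (cubeM I) unit_lborel"
      using True by measurable
    then show ?thesis
      by (simp add: measurable_restrict_space2_iff)
  next
    case False
    have "(\<lambda>x. x i) \<in> borel_measurable (cubeM I) \<longleftrightarrow> (\<lambda>x. undefined::real) \<in> borel_measurable (cubeM I)"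
      by (rule measurable_cong) (use False in \<open>auto simp: space_PiM\<close>)
    then show ?thesis by simp
  qed
qed

lemma continuous_measurable_cubeM:
  fixes f :: "(nat \<Rightarrow> real) \<Rightarrow> 'b::topological_space"
  assumes "continuous_on UNIV f"
  shows "f \<in> borel_measurable (cubeM I)"
  using measurable_compose[OF measurable_cubeM_borel borel_measurable_continuous_onI[OF assms]] .

lemma closed_sets_cubeM:
  assumes "closed C"
  shows "C \<inter> space (cubeM I) \<in> sets (cubeM I)"
  using measurable_sets[OF measurable_cubeM_borel[of I], of C] assms by simp

lemma continuous_on_merge:
  "continuous_on UNIV (\<lambda>x. merge I J (z, x) :: nat \<Rightarrow> real)"
proof (rule continuous_on_coordinatewise_then_product)
  fix i show "continuous_on UNIV (\<lambda>x. merge I J (z, x) i)"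
    by (cases "i \<in> I"; cases "i \<in> J") (simp_all add: merge_def)
qed

lemma continuous_on_fun_upd:
  "continuous_on UNIV (\<lambda>x. x(i := c) :: nat \<Rightarrow> real)"
proof (rule continuous_on_coordinatewise_then_product)
  fix k show "continuous_on UNIV (\<lambda>x. (x(i := c)) k)"
    by (cases "k = i") simp_all
qed

text \<open>Tychonoff: an extensional product over \<open>I\<close> is a product over all of
  \<open>nat\<close> whose factors off \<open>I\<close> are the singleton of
  \<open>undefined\<close>.\<close>

lemma compact_PiE_real:
  fixes S :: "nat \<Rightarrow> real set"
  assumes "\<And>i. i \<in> I \<Longrightarrow> compact (S i)"
  shows "compact (PiE I S)"
proof -
  have "PiE I S = PiE UNIV (\<lambda>i. if i \<in> I then S i else {undefined})"
    by (fastforce simp: PiE_def extensional_def Pi_def split: if_splits)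
  moreover have "compactin (product_topology (\<lambda>_. euclidean) UNIV) (PiE UNIV (\<lambda>i. if i \<in> I then S i else {undefined}))"
    unfolding compactin_PiE using assms by (auto simp: compactin_euclidean_iff)
  ultimately show ?thesis
    by (simp add: euclidean_product_topology flip: compactin_euclidean_iff)
qed

lemma emeasure_lborel_flip:
  assumes N: "N > 0" and A: "A \<in> sets unit_lborel"
  shows "emeasure lborel {t \<in> {0..N}. 1 - t / N \<in> A} = ennreal N * emeasure unit_lborel A"
proof -
  have A1: "A \<subseteq> {0..1}" "A \<in> sets borel"
    using A sets.sets_into_space[OF A] by (auto simp: space_restrict_space sets_restrict_space)
  have "emeasure unit_lborel A = emeasure lborel A"
    using A1 by (simp add: emeasure_restrict_space)
  also have "\<dots> = (\<integral>\<^sup>+t. indicator A t \<partial>lborel)"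
    using A1 by simp
  also have "\<dots> = ennreal \<bar>- 1 / N\<bar> * (\<integral>\<^sup>+t. indicator A (1 + (- 1 / N) * t) \<partial>lborel)"
    using A1 N by (intro nn_integral_real_affine) auto
  also have "(\<integral>\<^sup>+t. indicator A (1 + (- 1 / N) * t) \<partial>lborel) =
      (\<integral>\<^sup>+t. indicator {t \<in> {0..N}. 1 - t / N \<in> A} t \<partial>lborel)"
    using A1 N by (intro nn_integral_cong) (auto simp: indicator_def subset_iff field_simps)
  also have "\<dots> = emeasure lborel {t \<in> {0..N}. 1 - t / N \<in> A}"
    by (rule nn_integral_indicator) (use A1 in measurable)
  finally show ?thesis
    using N by (simp add: mult.assoc[symmetric] ennreal_mult[symmetric])
qed

text \<open>The substitution \<open>y = N (1 - x)\<close> in \<open>card K\<close> dimensions,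
  combined with a renaming \<open>b\<close> of coordinates: deficiencies are stated for the indices
  \<open>{..<r}\<close>, while a bundle is an arbitrary set of items.\<close>

lemma emeasure_flip_box:
  fixes b :: "nat \<Rightarrow> nat"
  assumes K: "finite K" and b: "bij_betw b K J" and N: "N > 0" and E: "E \<in> sets (cubeM J)"
  shows "emeasure (PiM K (\<lambda>_. lborel))
      {y \<in> PiE K (\<lambda>_. {0..N}). (\<lambda>i\<in>J. 1 - y (the_inv_into K b i) / N) \<in> E} =
    ennreal N ^ card K * emeasure (cubeM J) E"
    (is "emeasure ?P (?A E) = _")
proof -
  define \<Phi> where "\<Phi> = (\<lambda>y::nat \<Rightarrow> real. \<lambda>i\<in>J. 1 - y (the_inv_into K b i) / N)"
  define R where "R = restrict_space ?P (PiE K (\<lambda>_. {0..N}))"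
  have c1: "ennreal (1 / N ^ card K) * ennreal N ^ card K = 1"
    using N by (simp add: ennreal_power ennreal_mult[symmetric])
  have J: "finite J" "card J = card K" using b K bij_betw_finite bij_betw_same_card by metis+
  have inv: "the_inv_into K b i \<in> K" "b (the_inv_into K b i) = i" if "i \<in> J" for i
    using that b by (auto simp: bij_betw_def f_the_inv_into_f the_inv_into_into)
  have inv2: "the_inv_into K b (b k) = k" "b k \<in> J" if "k \<in> K" for k
    using that b by (auto simp: bij_betw_def the_inv_into_f_f)
  have box: "PiE K (\<lambda>_. {0..N}) \<in> sets ?P"
    using K by (intro sets_PiM_I_finite) auto
  have R: "space R = PiE K (\<lambda>_. {0..N})"
    unfolding R_def by (auto simp: space_restrict_space space_PiM)
  have \<Phi>[measurable]: "\<Phi> \<in> measurable R (cubeM J)"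
    unfolding \<Phi>_def
  proof (rule measurable_restrict, rule measurable_restrict_space2)
    fix i assume i: "i \<in> J"
    then show "(\<lambda>y. 1 - y (the_inv_into K b i) / N) \<in> space R \<rightarrow> {0..1}"
      using inv[OF i] N by (auto simp: R PiE_def Pi_def)
    show "(\<lambda>y. 1 - y (the_inv_into K b i) / N) \<in> measurable R lborel"
      unfolding R_def using inv[OF i] by (intro measurable_restrict_space1) simp
  qed
  \<comment> \<open>A product measure is determined by its values on boxes, where both sides factor
    into the one-dimensional flip.\<close>
  have "scale_measure (ennreal (1 / N ^ card K)) (distr R (cubeM J) \<Phi>) = cubeM J"
  proof (rule cube.PiM_eqI)
    fix A assume A: "\<And>i. i \<in> J \<Longrightarrow> A i \<in> sets unit_lborel"
    define B where "B k = {t \<in> {0..N}. 1 - t / N \<in> A (b k)}" for k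
    have A': "\<And>i. i \<in> J \<Longrightarrow> A i \<in> sets borel"
      using A by (force simp: sets_restrict_space)
    have B: "B k \<in> sets lborel" if "k \<in> K" for k
      unfolding B_def using A'[OF inv2(2)[OF that]] by measurable
    have vim: "\<Phi> -` PiE J A \<inter> space R = PiE K B"
    proof (intro set_eqI iffI)
      fix y assume y: "y \<in> \<Phi> -` PiE J A \<inter> space R"
      then have "1 - y k / N \<in> A (b k)" if "k \<in> K" for k
        using inv2[OF that] by (auto simp: \<Phi>_def PiE_def Pi_def)
      with y show "y \<in> PiE K B" by (auto simp: B_def R PiE_def Pi_def)
    next
      fix y assume y: "y \<in> PiE K B"
      then have "1 - y (the_inv_into K b i) / N \<in> A i" if "i \<in> J" for i
        using inv[OF that] by (force simp: B_def PiE_def Pi_def)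
      with y show "y \<in> \<Phi> -` PiE J A \<inter> space R"
        by (auto simp: \<Phi>_def R B_def PiE_def Pi_def)
    qed
    have "emeasure (distr R (cubeM J) \<Phi>) (PiE J A) = emeasure R (PiE K B)"
      using A J by (subst emeasure_distr) (auto simp: vim intro!: sets_PiM_I_finite)
    also have "\<dots> = emeasure ?P (PiE K B)"
      unfolding R_def using box
      by (intro emeasure_restrict_space) (auto simp: B_def space_PiM PiE_def Pi_def)
    also have "\<dots> = (\<Prod>k\<in>K. emeasure lborel (B k))"
      using B K by (rule box.emeasure_PiM[rotated])
    also have "\<dots> = (\<Prod>k\<in>K. ennreal N * emeasure unit_lborel (A (b k)))"
      unfolding B_def using inv2 A N by (intro prod.cong refl emeasure_lborel_flip) auto
    also have "\<dots> = ennreal N ^ card K * (\<Prod>i\<in>J. emeasure unit_lborel (A i))"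
      using prod.reindex_bij_betw[OF b, of "\<lambda>i. emeasure unit_lborel (A i)"]
      by (simp add: prod.distrib)
    finally show "emeasure (scale_measure (ennreal (1 / N ^ card K)) (distr R (cubeM J) \<Phi>)) (PiE J A) =
        (\<Prod>i\<in>J. emeasure unit_lborel (A i))"
      by (simp add: mult.assoc[symmetric] c1)
  qed (use J in simp_all)
  then have "emeasure (cubeM J) E = ennreal (1 / N ^ card K) * emeasure (distr R (cubeM J) \<Phi>) E"
    by (metis emeasure_scale_measure)
  also have "emeasure (distr R (cubeM J) \<Phi>) E = emeasure R (?A E)"
    using E \<Phi> by (subst emeasure_distr) (auto simp: R \<Phi>_def intro!: arg_cong[where f="emeasure R"])
  also have "\<dots> = emeasure ?P (?A E)"
    unfolding R_def using box
    by (intro emeasure_restrict_space) (auto simp: space_PiM PiE_def Pi_def)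
  finally have "emeasure (cubeM J) E = ennreal (1 / N ^ card K) * emeasure ?P (?A E)" .
  then show ?thesis
    by (simp only: mult.assoc[symmetric] mult.commute[of "ennreal N ^ card K"] c1 mult_1_left)
qed

section \<open>Deficiency and faces\<close>

text \<open>The flipped copy \<open>A\<close> of \<open>E\<close> is a body inside the SIM-body. As
  \<open>E\<close> is closed under raising a coordinate to 1, \<open>A\<close> is closed under
  lowering a coordinate to 0, so each projection of \<open>A\<close> is a flipped face of
  \<open>E\<close>, and the deficiency of \<open>A\<close> compares the volume of \<open>E\<close>
  with the volumes of its faces.\<close>

lemma nonpos_deficiency_face_bound:
  fixes N :: real
  assumes J: "finite J" "J \<noteq> {}" and N: "N > 0"
    and E: "closed E" "E \<subseteq> PiE J (\<lambda>_. {0..1})"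
    and up: "\<And>x j. x \<in> E \<Longrightarrow> j \<in> J \<Longrightarrow> x(j := 1) \<in> E"
    and SIM: "\<And>x L. x \<in> E \<Longrightarrow> L \<subseteq> J \<Longrightarrow>
      N * (\<Sum>i\<in>L. 1 - x i) \<le> (\<Sum>i\<in>{card J - card L + 1..card J}. \<alpha> i)"
    and nodef: "\<And>A. body (card J) A \<Longrightarrow> A \<subseteq> SIM_body (card J) \<alpha> \<Longrightarrow> deficiency 1 (card J) A \<le> 0"
  shows "ennreal N * emeasure (cubeM J) E \<le>
    (\<Sum>j\<in>J. emeasure (cubeM (J - {j})) {x \<in> space (cubeM (J - {j})). x(j := 1) \<in> E})"
proof -
  define r where "r = card J"
  obtain b where b: "bij_betw b {..<r} J"
    using ex_bij_betw_nat_finite[OF J(1)] by (auto simp: r_def atLeast0LessThan)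
  define F where "F j = {x \<in> space (cubeM (J - {j})). x(j := 1) \<in> E}" for j
  define \<Phi> where "\<Phi> = (\<lambda>y::nat \<Rightarrow> real. \<lambda>i\<in>J. 1 - y (the_inv_into {..<r} b i) / N)"
  define A where "A = {y \<in> PiE {..<r} (\<lambda>_. {0..N}). \<Phi> y \<in> E}"
  have r: "r > 0" using J by (simp add: r_def card_gt_0_iff)
  have inv: "the_inv_into {..<r} b i < r" "b (the_inv_into {..<r} b i) = i" if "i \<in> J" for i
    using that b the_inv_into_into[of b "{..<r}" i "{..<r}"]
    by (auto simp: bij_betw_def f_the_inv_into_f)
  have inv2: "the_inv_into {..<r} b (b k) = k" "b k \<in> J" if "k < r" for k
    using that b by (auto simp: bij_betw_def the_inv_into_f_f)
  \<comment> \<open>Dropping index \<open>k\<close> drops item \<open>b k\<close>. The inverse of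
    the restricted bijection agrees with the old inverse, so the flips of the body and of its
    projections are compatible.\<close>
  have bk: "bij_betw b ({..<r} - {k}) (J - {b k})" if "k < r" for k
    using b that unfolding bij_betw_def by (auto simp: inj_on_def)
  have invk: "the_inv_into ({..<r} - {k}) b i = the_inv_into {..<r} b i" if "k < r" "i \<in> J - {b k}" for k i
  proof (rule the_inv_into_f_eq)
    show "inj_on b ({..<r} - {k})" using bk[OF that(1)] by (simp add: bij_betw_def)
    show "b (the_inv_into {..<r} b i) = i" using inv that by auto
    show "the_inv_into {..<r} b i \<in> {..<r} - {k}" using inv that by auto
  qed
  have Eset: "E \<in> sets (cubeM J)"
    using closed_sets_cubeM[OF E(1), of J] E(2) by (simp add: space_cubeM Int_absorb2)
  have Fset: "F j \<in> sets (cubeM (J - {j}))" for j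
  proof -
    have "closed ((\<lambda>x. x(j := 1)) -` E)"
      using E(1) continuous_on_fun_upd by (intro closed_vimage) auto
    from closed_sets_cubeM[OF this, of "J - {j}"] show ?thesis
      by (simp add: F_def Collect_conj_eq vimage_def Int_commute)
  qed
  have contP: "continuous_on UNIV \<Phi>"
  proof (rule continuous_on_coordinatewise_then_product)
    fix i show "continuous_on UNIV (\<lambda>y. \<Phi> y i)"
      by (cases "i \<in> J") (use N in \<open>auto simp: \<Phi>_def intro!: continuous_intros\<close>)
  qed
  have "compact A"
  proof -
    have "A = PiE {..<r} (\<lambda>_. {0..N}) \<inter> \<Phi> -` E" by (auto simp: A_def)
    moreover have "closed (\<Phi> -` E)" using contP E(1) by (intro closed_vimage) auto
    ultimately show ?thesis using compact_PiE_real[of "{..<r}" "\<lambda>_. {0..N}"] by auto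
  qed
  then have body: "body r A" unfolding body_def A_def by (auto simp: PiE_def Pi_def)
  have \<Phi>b: "N * (1 - \<Phi> y (b k)) = y k" if "k < r" for y k
    using inv2[OF that] N by (simp add: \<Phi>_def)
  have "A \<subseteq> SIM_body r \<alpha>"
  proof
    fix y assume y: "y \<in> A"
    have "(\<Sum>j\<in>K. y j) \<le> (\<Sum>j\<in>{r - card K + 1..r}. \<alpha> j)" if K: "K \<subseteq> {..<r}" for K
    proof -
      have inj: "inj_on b K" using b K by (auto simp: bij_betw_def intro: inj_on_subset)
      have "(\<Sum>j\<in>K. y j) = (\<Sum>k\<in>K. N * (1 - \<Phi> y (b k)))"
        using K by (intro sum.cong refl) (auto simp: \<Phi>b)
      also have "\<dots> = N * (\<Sum>i\<in>b ` K. 1 - \<Phi> y i)"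
        by (simp add: sum.reindex[OF inj] sum_distrib_left)
      also have "\<dots> \<le> (\<Sum>i\<in>{card J - card (b ` K) + 1..card J}. \<alpha> i)"
        using y K inv2 by (intro SIM) (auto simp: A_def)
      finally show ?thesis using inj by (simp add: card_image r_def)
    qed
    with y show "y \<in> SIM_body r \<alpha>" by (auto simp: SIM_body_def A_def PiE_def Pi_def)
  qed
  with body nodef have def: "deficiency 1 r A \<le> 0" by (simp add: r_def)
  \<comment> \<open>A point that is projected along \<open>k\<close> may be assumed to have
    coordinate 0 there, that is, to come from the face where item \<open>b k\<close> has value
    1.\<close>
  have proj: "(\<lambda>x. restrict x ({..<r} - {k})) ` A =
      {y \<in> PiE ({..<r} - {k}) (\<lambda>_. {0..N}).
        (\<lambda>i\<in>J - {b k}. 1 - y (the_inv_into ({..<r} - {k}) b i) / N) \<in> F (b k)}" (is "_ = ?R")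
    if k: "k < r" for k
  proof (intro set_eqI iffI)
    fix y assume "y \<in> (\<lambda>x. restrict x ({..<r} - {k})) ` A"
    then obtain x where x: "x \<in> A" and y: "y = restrict x ({..<r} - {k})" by auto
    have eq: "(\<lambda>i\<in>J - {b k}. 1 - y (the_inv_into ({..<r} - {k}) b i) / N) = restrict (\<Phi> x) (J - {b k})"
      using k inv by (auto simp: y \<Phi>_def fun_eq_iff invk)
    have "(restrict (\<Phi> x) (J - {b k}))(b k := 1) = (\<Phi> x)(b k := 1)"
      by (auto simp: fun_eq_iff \<Phi>_def)
    moreover have "(\<Phi> x)(b k := 1) \<in> E" using x inv2[OF k] by (intro up) (auto simp: A_def)
    moreover have "restrict (\<Phi> x) (J - {b k}) \<in> space (cubeM (J - {b k}))"
      using x E(2) by (auto simp: A_def space_cubeM PiE_def Pi_def)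
    ultimately have "restrict (\<Phi> x) (J - {b k}) \<in> F (b k)" by (simp add: F_def)
    moreover have "y \<in> PiE ({..<r} - {k}) (\<lambda>_. {0..N})"
      using x unfolding y A_def by (simp add: PiE_def Pi_def)
    ultimately show "y \<in> ?R" unfolding mem_Collect_eq eq by (rule conjI[rotated])
  next
    fix y assume y: "y \<in> ?R"
    define x where "x = y(k := 0)"
    have "\<Phi> x = (\<lambda>i\<in>J - {b k}. 1 - y (the_inv_into ({..<r} - {k}) b i) / N)(b k := 1)"
      using inv2[OF k] inv by (auto simp: fun_eq_iff \<Phi>_def x_def invk[OF k])
    then have "\<Phi> x \<in> E" using y by (simp add: F_def)
    then have "x \<in> A" using y k N by (auto simp: A_def x_def PiE_def Pi_def extensional_def)
    moreover have "y = restrict x ({..<r} - {k})"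
      using y by (auto simp: x_def fun_eq_iff PiE_def extensional_def)
    ultimately show "y \<in> (\<lambda>x. restrict x ({..<r} - {k})) ` A" by blast
  qed
  interpret J: prob_space "cubeM J" using J(1) by (rule prob_space_cubeM)
  have volA: "measure (PiM {..<r} (\<lambda>_. lborel)) A = N ^ r * measure (cubeM J) E"
    using emeasure_flip_box[OF _ b N Eset] N
    by (simp add: A_def \<Phi>_def measure_def enn2real_mult ennreal_power)
  have volF: "measure (PiM ({..<r} - {k}) (\<lambda>_. lborel)) ((\<lambda>x. restrict x ({..<r} - {k})) ` A) =
      N ^ (r - 1) * measure (cubeM (J - {b k})) (F (b k))" if k: "k < r" for k
    using emeasure_flip_box[OF _ bk[OF k] N Fset] N k
    by (simp add: proj[OF k] measure_def enn2real_mult ennreal_power)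
  \<comment> \<open>Nonpositive deficiency after the change of variables. Cancelling
    \<open>N ^ (r - 1)\<close> will leave a single factor \<open>N\<close>.\<close>
  have "N ^ r * measure (cubeM J) E \<le> N ^ (r - 1) * (\<Sum>k<r. measure (cubeM (J - {b k})) (F (b k)))"
    using def by (simp add: deficiency_def volA volF sum_distrib_left)
  also have "(\<Sum>k<r. measure (cubeM (J - {b k})) (F (b k))) = (\<Sum>j\<in>J. measure (cubeM (J - {j})) (F j))"
    by (rule sum.reindex_bij_betw[OF b])
  also have "N ^ r = N ^ (r - 1) * N" using r by (cases r) auto
  finally have le: "N * measure (cubeM J) E \<le> (\<Sum>j\<in>J. measure (cubeM (J - {j})) (F j))"
    using N by (simp add: mult.assoc)
  have emF: "emeasure (cubeM (J - {j})) (F j) = ennreal (measure (cubeM (J - {j})) (F j))" for j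
    using prob_space_cubeM[of "J - {j}"] J(1)
    by (intro finite_measure.emeasure_eq_measure) (simp add: prob_space.finite_measure)
  have "ennreal N * emeasure (cubeM J) E = ennreal (N * measure (cubeM J) E)"
    using N by (simp add: J.emeasure_eq_measure ennreal_mult)
  also have "\<dots> \<le> ennreal (\<Sum>j\<in>J. measure (cubeM (J - {j})) (F j))"
    using le by (rule ennreal_leI)
  also have "\<dots> = (\<Sum>j\<in>J. emeasure (cubeM (J - {j})) (F j))"
    by (simp add: emF sum_ennreal)
  finally show ?thesis by (simp add: F_def)
qed

section \<open>Null hyperplanes, levels and sections\<close>

lemma AE_cubeM_hyperplane:
  assumes I: "finite I" "i \<in> I" and c: "c i \<noteq> 0"
  shows "AE x in cubeM I. (\<Sum>k\<in>I. c k * x k) \<noteq> b"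
proof -
  define H where "H = {x. (\<Sum>k\<in>I. c k * x k) = b}"
  have "closed H" unfolding H_def
    by (intro closed_Collect_eq continuous_intros continuous_on_product_coordinates)
  then have H: "H \<inter> space (cubeM I) \<in> sets (cubeM I)" by (rule closed_sets_cubeM)
  have I': "insert i (I - {i}) = I" using I by auto
  have "emeasure (cubeM I) (H \<inter> space (cubeM I)) =
      (\<integral>\<^sup>+ x. indicator (H \<inter> space (cubeM I)) x \<partial>cubeM I)"
    using H by simp
  also have "\<dots> = (\<integral>\<^sup>+ x. (\<integral>\<^sup>+ y. indicator (H \<inter> space (cubeM I)) (x(i := y)) \<partial>unit_lborel) \<partial>cubeM (I - {i}))"
    using cube.product_nn_integral_insert[of "I - {i}" i "indicator (H \<inter> space (cubeM I))"] I H
    unfolding I' by simp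
  also have "\<dots> \<le> (\<integral>\<^sup>+ x. 0 \<partial>cubeM (I - {i}))"
  proof (rule nn_integral_mono)
    fix x
    \<comment> \<open>With the other coordinates fixed, \<open>t\<close> is the only value of
      coordinate \<open>i\<close> on the hyperplane, and a single point is null.\<close>
    define t where "t = (b - (\<Sum>k\<in>I - {i}. c k * x k)) / c i"
    have sub: "y = t" if "x(i := y) \<in> H" for y
    proof -
      have "(\<Sum>k\<in>I. c k * (x(i := y)) k) = c i * y + (\<Sum>k\<in>I - {i}. c k * (x(i := y)) k)"
        using I by (simp add: sum.remove)
      also have "(\<Sum>k\<in>I - {i}. c k * (x(i := y)) k) = (\<Sum>k\<in>I - {i}. c k * x k)"
        by (intro sum.cong) auto
      finally show ?thesis using that c by (simp add: H_def t_def field_simps)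
    qed
    have "(\<integral>\<^sup>+ y. indicator (H \<inter> space (cubeM I)) (x(i := y)) \<partial>unit_lborel) \<le>
        (\<integral>\<^sup>+ y. indicator {t} y \<partial>lborel)"
      by (subst nn_integral_restrict_space, simp, intro nn_integral_mono)
        (auto simp: indicator_def dest: sub)
    then show "(\<integral>\<^sup>+ y. indicator (H \<inter> space (cubeM I)) (x(i := y)) \<partial>unit_lborel) \<le> 0"
      by simp
  qed
  finally have "H \<inter> space (cubeM I) \<in> null_sets (cubeM I)" using H by (simp add: null_sets_def)
  from AE_not_in[OF this] show ?thesis
    by (rule AE_mp) (auto simp: H_def intro!: AE_I2)
qed

text \<open>Tonelli for the set under the graph. The condition \<open>0 < t\<close> discards
  negative values just as \<open>ennreal\<close> does, and the non-strict \<open>t \<le> f x\<close>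
  gives closed superlevel sets for the functions it is applied to, as bodies have to be
  compact.\<close>

lemma nn_integral_layer_cake:
  assumes "sigma_finite_measure M" and f[measurable]: "f \<in> borel_measurable M"
  shows "(\<integral>\<^sup>+ x. ennreal (f x) \<partial>M) = (\<integral>\<^sup>+ t. emeasure M {x \<in> space M. 0 < t \<and> t \<le> f x} \<partial>lborel)"
proof -
  interpret sigma_finite_measure M by fact
  interpret P: pair_sigma_finite M lborel by standard
  have "(\<integral>\<^sup>+ x. ennreal (f x) \<partial>M) = (\<integral>\<^sup>+ x. (\<integral>\<^sup>+ t. indicator {(x, t). 0 < t \<and> t \<le> f x} (x, t) \<partial>lborel) \<partial>M)"
  proof (rule nn_integral_cong)
    fix x
    have "ennreal (f x) = emeasure lborel {0<..f x}"
      by (cases "0 \<le> f x") (auto simp: ennreal_neg)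
    also have "\<dots> = (\<integral>\<^sup>+ t. indicator {0<..f x} t \<partial>lborel)" by simp
    also have "\<dots> = (\<integral>\<^sup>+ t. indicator {(x, t). 0 < t \<and> t \<le> f x} (x, t) \<partial>lborel)"
      by (intro nn_integral_cong) (auto simp: indicator_def)
    finally show "ennreal (f x) = \<dots>" .
  qed
  also have "\<dots> = (\<integral>\<^sup>+ t. (\<integral>\<^sup>+ x. indicator {(x, t). 0 < t \<and> t \<le> f x} (x, t) \<partial>M) \<partial>lborel)"
    by (rule P.Fubini'[symmetric]) measurable
  also have "\<dots> = (\<integral>\<^sup>+ t. emeasure M {x \<in> space M. 0 < t \<and> t \<le> f x} \<partial>lborel)"
  proof (rule nn_integral_cong)
    fix t
    have "(\<integral>\<^sup>+ x. indicator {(x, t). 0 < t \<and> t \<le> f x} (x, t) \<partial>M) =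
      (\<integral>\<^sup>+ x. indicator {x \<in> space M. 0 < t \<and> t \<le> f x} x \<partial>M)"
      by (intro nn_integral_cong) (auto simp: indicator_def)
    also have "\<dots> = emeasure M {x \<in> space M. 0 < t \<and> t \<le> f x}"
      by (rule nn_integral_indicator) measurable
    finally show "(\<integral>\<^sup>+ x. indicator {(x, t). 0 < t \<and> t \<le> f x} (x, t) \<partial>M) = \<dots>" .
  qed
  finally show ?thesis .
qed

lemma measurable_level_emeasure:
  assumes "sigma_finite_measure M" and f[measurable]: "f \<in> borel_measurable M"
  shows "(\<lambda>t::real. emeasure M {x \<in> space M. 0 < t \<and> t \<le> f x}) \<in> borel_measurable lborel"
proof -
  interpret sigma_finite_measure M by fact
  show ?thesis by measurable
qed

text \<open>With the coordinates \<open>z\<close> outside \<open>J\<close> fixed, the section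
  \<open>Sl z\<close> is a closed set in the coordinates \<open>J\<close> to which the face bound
  applies; integrating over \<open>z\<close> reassembles both sides by Tonelli.\<close>

lemma nonpos_deficiency_section_bound:
  fixes N :: real
  assumes I: "finite I" "J \<subseteq> I" "J \<noteq> {}" and N: "N > 0"
    and S: "closed S" "S \<subseteq> PiE I (\<lambda>_. {0..1})"
    and up: "\<And>x j. x \<in> S \<Longrightarrow> j \<in> J \<Longrightarrow> x(j := 1) \<in> S"
    and SIM: "\<And>x L. x \<in> S \<Longrightarrow> L \<subseteq> J \<Longrightarrow>
      N * (\<Sum>i\<in>L. 1 - x i) \<le> (\<Sum>i\<in>{card J - card L + 1..card J}. \<alpha> i)"
    and nodef: "\<And>A. body (card J) A \<Longrightarrow> A \<subseteq> SIM_body (card J) \<alpha> \<Longrightarrow> deficiency 1 (card J) A \<le> 0"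
  shows "ennreal N * emeasure (cubeM I) S \<le>
    (\<Sum>j\<in>J. emeasure (cubeM (I - {j})) {x \<in> space (cubeM (I - {j})). x(j := 1) \<in> S})"
proof -
  define Sl where "Sl z = {x \<in> PiE J (\<lambda>_. {0..1}). merge (I - J) J (z, x) \<in> S}" for z
  define F where "F j = {x \<in> space (cubeM (I - {j})). x(j := 1) \<in> S}" for j
  define G where "G j z = {x \<in> space (cubeM (J - {j})). x(j := 1) \<in> Sl z}" for j z
  have J: "finite J" using I finite_subset by blast
  have Sset[measurable]: "S \<in> sets (cubeM I)"
    using closed_sets_cubeM[OF S(1), of I] S(2) by (simp add: space_cubeM Int_absorb2)
  have cl_upd: "closed ((\<lambda>x. x(j := 1)) -` C)" if "closed C" for j and C :: "(nat \<Rightarrow> real) set"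
    using that continuous_on_fun_upd by (intro closed_vimage) auto
  have Fset[measurable]: "F j \<in> sets (cubeM (I - {j}))" for j
    using closed_sets_cubeM[OF cl_upd[OF S(1)], of j "I - {j}"]
    by (simp add: F_def Collect_conj_eq vimage_def Int_commute)
  have Slcl: "closed (Sl z)" for z
  proof -
    have "Sl z = PiE J (\<lambda>_. {0..1}) \<inter> (\<lambda>x. merge (I - J) J (z, x)) -` S" by (auto simp: Sl_def)
    moreover have "closed ((\<lambda>x. merge (I - J) J (z, x)) -` S)"
      using S(1) continuous_on_merge by (intro closed_vimage) auto
    ultimately show ?thesis
      using compact_imp_closed[OF compact_PiE_real[of J "\<lambda>_. {0..1}"]] by auto
  qed
  have Slset: "Sl z \<in> sets (cubeM J)" for z
  proof -
    have "Sl z \<inter> space (cubeM J) = Sl z" by (auto simp: Sl_def space_cubeM)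
    with closed_sets_cubeM[OF Slcl, of z J] show ?thesis by simp
  qed
  have Gset: "G j z \<in> sets (cubeM (J - {j}))" for j z
    using closed_sets_cubeM[OF cl_upd[OF Slcl], of j z "J - {j}"]
    by (simp add: G_def Collect_conj_eq vimage_def Int_commute)
  have slice: "ennreal N * emeasure (cubeM J) (Sl z) \<le> (\<Sum>j\<in>J. emeasure (cubeM (J - {j})) (G j z))" for z
    unfolding G_def
  proof (rule nonpos_deficiency_face_bound[OF J I(3) N Slcl])
    show "Sl z \<subseteq> PiE J (\<lambda>_. {0..1})" by (auto simp: Sl_def)
    show "x(j := 1) \<in> Sl z" if "x \<in> Sl z" "j \<in> J" for x j
    proof -
      have "merge (I - J) J (z, x(j := 1)) = (merge (I - J) J (z, x))(j := 1)"
        using that by (auto simp: merge_def fun_eq_iff)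
      with that up show ?thesis by (auto simp: Sl_def PiE_def Pi_def extensional_def)
    qed
    show "N * (\<Sum>i\<in>L. 1 - x i) \<le> (\<Sum>i\<in>{card J - card L + 1..card J}. \<alpha> i)"
      if "x \<in> Sl z" "L \<subseteq> J" for x L
    proof -
      have "(\<Sum>i\<in>L. 1 - x i) = (\<Sum>i\<in>L. 1 - merge (I - J) J (z, x) i)"
        using that by (intro sum.cong) (auto simp: merge_def)
      with that SIM[of "merge (I - J) J (z, x)" L] show ?thesis by (auto simp: Sl_def)
    qed
  qed (fact nodef)
  have IJ: "(I - J) \<union> J = I" "(I - J) \<union> (J - {j}) = I - {j}" if "j \<in> J" for j using I that by auto
  have IJ1: "(I - J) \<union> J = I" using I by auto
  have Sl_int: "(\<integral>\<^sup>+ y. indicator S (merge (I - J) J (z, y)) \<partial>cubeM J) = emeasure (cubeM J) (Sl z)" for z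
  proof -
    have "(\<integral>\<^sup>+ y. indicator S (merge (I - J) J (z, y)) \<partial>cubeM J) = (\<integral>\<^sup>+ y. indicator (Sl z) y \<partial>cubeM J)"
      by (intro nn_integral_cong) (auto simp: indicator_def Sl_def space_cubeM)
    then show ?thesis using Slset by simp
  qed
  have S_eq: "emeasure (cubeM I) S = (\<integral>\<^sup>+ z. emeasure (cubeM J) (Sl z) \<partial>cubeM (I - J))"
  proof -
    have "emeasure (cubeM I) S = (\<integral>\<^sup>+ x. indicator S x \<partial>cubeM I)" by simp
    also have "\<dots> = (\<integral>\<^sup>+ z. (\<integral>\<^sup>+ y. indicator S (merge (I - J) J (z, y)) \<partial>cubeM J) \<partial>cubeM (I - J))"
      using cube.product_nn_integral_fold[of "I - J" J "indicator S"] I(1) J Sset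
      unfolding IJ1 by (simp add: Diff_disjoint Int_commute)
    finally show ?thesis by (simp only: Sl_int)
  qed
  \<comment> \<open>Slicing commutes with passing to a face: the section of \<open>F j\<close> at
    \<open>z\<close> is the face \<open>G j z\<close> of \<open>Sl z\<close>.\<close>
  have G_int: "(\<integral>\<^sup>+ y. indicator (F j) (merge (I - J) (J - {j}) (z, y)) \<partial>cubeM (J - {j})) =
      emeasure (cubeM (J - {j})) (G j z)" if j: "j \<in> J" and z: "z \<in> space (cubeM (I - J))" for j z
  proof -
    have "indicator (F j) (merge (I - J) (J - {j}) (z, y)) = (indicator (G j z) y :: ennreal)"
      if y: "y \<in> space (cubeM (J - {j}))" for y
    proof -
      have "(merge (I - J) (J - {j}) (z, y))(j := 1) = merge (I - J) J (z, y(j := 1))"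
        using j by (auto simp: merge_def fun_eq_iff)
      moreover have "merge (I - J) (J - {j}) (z, y) \<in> space (cubeM (I - {j}))"
        using y z I j by (auto simp: space_cubeM merge_def PiE_def Pi_def extensional_def)
      moreover have "y(j := 1) \<in> PiE J (\<lambda>_. {0..1})"
        using y j by (auto simp: space_cubeM PiE_def Pi_def extensional_def)
      ultimately show ?thesis using y by (auto simp: F_def G_def Sl_def indicator_def)
    qed
    then have "(\<integral>\<^sup>+ y. indicator (F j) (merge (I - J) (J - {j}) (z, y)) \<partial>cubeM (J - {j})) =
        (\<integral>\<^sup>+ y. indicator (G j z) y \<partial>cubeM (J - {j}))"
      by (intro nn_integral_cong)
    then show ?thesis using Gset by simp
  qed
  have F_eq: "emeasure (cubeM (I - {j})) (F j) = (\<integral>\<^sup>+ z. emeasure (cubeM (J - {j})) (G j z) \<partial>cubeM (I - J))"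
    if j: "j \<in> J" for j
  proof -
    have "emeasure (cubeM (I - {j})) (F j) = (\<integral>\<^sup>+ x. indicator (F j) x \<partial>cubeM (I - {j}))" by simp
    also have "\<dots> = (\<integral>\<^sup>+ z. (\<integral>\<^sup>+ y. indicator (F j) (merge (I - J) (J - {j}) (z, y)) \<partial>cubeM (J - {j})) \<partial>cubeM (I - J))"
      using cube.product_nn_integral_fold[of "I - J" "J - {j}" "indicator (F j)"] I(1) J Fset[of j]
      unfolding IJ(2)[OF j] by auto
    also have "\<dots> = (\<integral>\<^sup>+ z. emeasure (cubeM (J - {j})) (G j z) \<partial>cubeM (I - J))"
      using G_int[OF j] by (rule nn_integral_cong)
    finally show ?thesis .
  qed
  \<comment> \<open>Measurability in \<open>z\<close> is inherited from the partial integrals of the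
    indicator of \<open>F j\<close>, with which these volumes agree.\<close>
  have meas: "(\<lambda>z. emeasure (cubeM (J - {j})) (G j z)) \<in> borel_measurable (cubeM (I - J))" if j: "j \<in> J" for j
  proof -
    have "(\<lambda>p. indicator (F j) (merge (I - J) (J - {j}) p) :: ennreal) \<in>
        borel_measurable (cubeM (I - J) \<Otimes>\<^sub>M cubeM (J - {j}))"
      using measurable_merge[of "I - J" "J - {j}" "\<lambda>_. unit_lborel"] Fset[of j]
      unfolding IJ(2)[OF j] by (intro measurable_compose[OF _ borel_measurable_indicator])
    then have "(\<lambda>z. \<integral>\<^sup>+ y. indicator (F j) (merge (I - J) (J - {j}) (z, y)) \<partial>cubeM (J - {j}))
        \<in> borel_measurable (cubeM (I - J))"
      using J by (intro sigma_finite_measure.borel_measurable_nn_integral cube.sigma_finite) (auto simp: case_prod_unfold)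
    then show ?thesis by (rule measurable_cong[THEN iffD1, rotated]) (use G_int[OF j] in auto)
  qed
  have "ennreal N * emeasure (cubeM I) S \<le> (\<integral>\<^sup>+ z. ennreal N * emeasure (cubeM J) (Sl z) \<partial>cubeM (I - J))"
  proof -
    have "(\<lambda>p. indicator S (merge (I - J) J p) :: ennreal) \<in>
        borel_measurable (cubeM (I - J) \<Otimes>\<^sub>M cubeM J)"
      using measurable_merge[of "I - J" J "\<lambda>_. unit_lborel"] Sset
      unfolding IJ1 by (intro measurable_compose[OF _ borel_measurable_indicator])
    then have "(\<lambda>z. \<integral>\<^sup>+ y. indicator S (merge (I - J) J (z, y)) \<partial>cubeM J)
        \<in> borel_measurable (cubeM (I - J))"
      using J by (intro sigma_finite_measure.borel_measurable_nn_integral cube.sigma_finite) (auto simp: case_prod_unfold)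
    then show ?thesis by (simp add: S_eq Sl_int nn_integral_cmult)
  qed
  also have "\<dots> \<le> (\<integral>\<^sup>+ z. (\<Sum>j\<in>J. emeasure (cubeM (J - {j})) (G j z)) \<partial>cubeM (I - J))"
    by (intro nn_integral_mono slice)
  also have "\<dots> = (\<Sum>j\<in>J. emeasure (cubeM (I - {j})) (F j))"
    using meas by (simp add: nn_integral_sum F_eq)
  finally show ?thesis by (simp add: F_def)
qed

section \<open>Regions of SJA\<close>

lemma sja_region_closed: "closed (sja_region m p J)"
proof -
  have "closed (cube m)"
    unfolding cube_def by (intro compact_imp_closed compact_PiE_real) auto
  moreover have "sja_region m p J = cube m \<inter> (\<Inter>L\<in>Pow {..<m}.
     {x. (\<Sum>j\<in>L. x j) - norm_prices m p (card L) \<le> (\<Sum>j\<in>J. x j) - norm_prices m p (card J)})"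
    by (auto simp: sja_region_def)
  moreover have "closed {x::nat \<Rightarrow> real. (\<Sum>j\<in>L. x j) - norm_prices m p (card L) \<le> (\<Sum>j\<in>J. x j) - norm_prices m p (card J)}" for L
    by (intro closed_Collect_le continuous_intros continuous_on_product_coordinates)
  ultimately show ?thesis by (metis (no_types, lifting) closed_INT closed_Int)
qed

lemma sum_fun_upd:
  fixes x :: "nat \<Rightarrow> real"
  assumes "finite L"
  shows "(\<Sum>k\<in>L. (x(j := t)) k) = (\<Sum>k\<in>L. x k) + (if j \<in> L then t - x j else 0)"
proof (cases "j \<in> L")
  case True
  have "(\<Sum>k\<in>L - {j}. (x(j := t)) k) = (\<Sum>k\<in>L - {j}. x k)" by (intro sum.cong) auto
  with True assms show ?thesis by (simp add: sum.remove[OF assms True])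
next
  case False
  then have "(\<Sum>k\<in>L. (x(j := t)) k) = (\<Sum>k\<in>L. x k)" by (intro sum.cong) auto
  with False show ?thesis by simp
qed

text \<open>Raising \<open>x j\<close> to 1 adds \<open>1 - x j\<close> to the surplus of
  \<open>J\<close> and at most as much to that of any other bundle.\<close>

lemma sja_region_upd:
  assumes "x \<in> sja_region m p J" "J \<subseteq> {..<m}" "j \<in> J"
  shows "x(j := 1) \<in> sja_region m p J"
proof -
  have fin: "finite L" if "L \<subseteq> {..<m}" for L using that finite_subset by blast
  have xc: "x \<in> cube m" using assms by (simp add: sja_region_def)
  then have "x(j := 1) \<in> cube m" "x j \<le> 1"
    using assms by (auto simp: cube_def PiE_def Pi_def extensional_def)
  moreover have "(\<Sum>k\<in>L. (x(j := 1)) k) - norm_prices m p (card L) \<le>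
      (\<Sum>k\<in>J. (x(j := 1)) k) - norm_prices m p (card J)" if L: "L \<subseteq> {..<m}" for L
  proof -
    have "(\<Sum>k\<in>L. x k) - norm_prices m p (card L) \<le> (\<Sum>k\<in>J. x k) - norm_prices m p (card J)"
      using assms L by (simp add: sja_region_def)
    then show ?thesis
      unfolding sum_fun_upd[OF fin[OF L]] sum_fun_upd[OF fin[OF assms(2)]]
      using assms(3) \<open>x j \<le> 1\<close> by auto
  qed
  ultimately show ?thesis by (simp add: sja_region_def)
qed

text \<open>Comparing \<open>J\<close> with the smaller bundle \<open>J - L\<close> bounds the total
  value of \<open>L\<close> from below by a difference of normalized prices. In terms of
  \<open>sja_mu\<close> this becomes a sum of \<open>sja_lambda\<close> by telescoping, which is the
  SIM-body constraint for \<open>y = (m + 1) (1 - x)\<close>.\<close>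

lemma sja_region_SIM:
  assumes x: "x \<in> sja_region m p J" and J: "J \<subseteq> {..<m}" and L: "L \<subseteq> J" and p0: "p 0 = 0"
  shows "(real m + 1) * (\<Sum>i\<in>L. 1 - x i) \<le> (\<Sum>i\<in>{card J - card L + 1..card J}. sja_lambda m p i)"
proof -
  define r where "r = card J"
  have fin: "finite J" "finite L" using J L by (meson finite_lessThan finite_subset)+
  have cL: "card L \<le> r" using fin L by (auto simp: r_def card_mono)
  \<comment> \<open>By \<open>p 0 = 0\<close> the formula also holds at \<open>s = 0\<close>, which
    the case \<open>L = J\<close> uses.\<close>
  have mu: "sja_mu m p s = (real m + 1) * (real s - norm_prices m p s)" for s
    by (auto simp: sja_mu_def norm_prices_def p0)
  have cJL: "card (J - L) = r - card L" using fin L by (simp add: r_def card_Diff_subset)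
  have "(\<Sum>i\<in>J - L. x i) - norm_prices m p (card (J - L)) \<le> (\<Sum>i\<in>J. x i) - norm_prices m p (card J)"
    using x J unfolding sja_region_def by blast
  moreover have "(\<Sum>i\<in>J. x i) = (\<Sum>i\<in>J - L. x i) + (\<Sum>i\<in>L. x i)"
    using sum.subset_diff[OF L fin(1)] by auto
  ultimately have "norm_prices m p r - norm_prices m p (r - card L) \<le> (\<Sum>i\<in>L. x i)"
    by (simp add: cJL r_def)
  then have "(real m + 1) * (real (card L) - (\<Sum>i\<in>L. x i)) \<le> (real m + 1) * (real (card L) - (norm_prices m p r - norm_prices m p (r - card L)))"
    by (intro mult_left_mono) auto
  also have "\<dots> = sja_mu m p r - sja_mu m p (r - card L)"
    using cL by (simp add: mu algebra_simps of_nat_diff)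
  also have "\<dots> = (\<Sum>i\<in>{Suc (r - card L)..r}. sja_lambda m p i)"
    using sum_telescope''[of "r - card L" r "sja_mu m p"] unfolding sja_lambda_def by simp
  finally show ?thesis by (simp add: sum_subtractf r_def)
qed

text \<open>Every superlevel set of \<open>g\<close> on the region is closed and stable under
  raising coordinates in \<open>J\<close> to 1, so the section bound holds at each positive level
  and integrates over all levels.\<close>

lemma sja_region_face_bound:
  assumes p0: "p 0 = 0" and J: "J \<subseteq> {..<m}" "J \<noteq> {}"
    and nodef: "\<And>A. sja_region m p J \<noteq> {} \<Longrightarrow> body (card J) A \<Longrightarrow> A \<subseteq> SIM_body (card J) (sja_lambda m p) \<Longrightarrow>
       deficiency 1 (card J) A \<le> 0"
    and g: "continuous_on UNIV g" "\<And>x. g x \<ge> 0"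
    and up: "\<And>x j. x \<in> sja_region m p J \<Longrightarrow> j \<in> J \<Longrightarrow> g x \<le> g (x(j := 1))"
  shows "ennreal (real m + 1) * (\<integral>\<^sup>+ x. ennreal (indicator (sja_region m p J) x * g x) \<partial>cubeM {..<m}) \<le>
    (\<Sum>j\<in>J. \<integral>\<^sup>+ x. ennreal (indicator (sja_region m p J) (x(j := 1)) * g (x(j := 1))) \<partial>cubeM ({..<m} - {j}))"
proof (cases "sja_region m p J = {}")
  case True
  then show ?thesis by simp
next
  case False
  define f where "f x = indicator (sja_region m p J) x * g x" for x
  define S where "S t = {x \<in> sja_region m p J. t \<le> g x}" for t
  have reg: "sja_region m p J \<subseteq> space (cubeM {..<m})"
    by (auto simp: sja_region_def space_cubeM cube_def)
  have [measurable]: "sja_region m p J \<in> sets borel"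
    using sja_region_closed by (rule borel_closed)
  have fb: "f \<in> borel_measurable borel"
    unfolding f_def using borel_measurable_continuous_onI[OF g(1)] by measurable
  have f1: "f \<in> borel_measurable (cubeM I)" for I
    using measurable_compose[OF measurable_cubeM_borel fb] .
  have f2: "(\<lambda>x. f (x(j := 1))) \<in> borel_measurable (cubeM I)" for I j
    using measurable_compose[OF continuous_measurable_cubeM[OF continuous_on_fun_upd] fb] .
  have sf: "sigma_finite_measure (cubeM I)" if "finite I" for I
    using that by (rule cube.sigma_finite)
  \<comment> \<open>Positive levels ignore the points outside the region, where \<open>f\<close>
    vanishes.\<close>
  have f_iff: "t \<le> f x \<longleftrightarrow> x \<in> S t" if "0 < t" for t x
    using that by (auto simp: f_def S_def indicator_def)
  have level: "ennreal (real m + 1) * emeasure (cubeM {..<m}) {x \<in> space (cubeM {..<m}). 0 < t \<and> t \<le> f x} \<le>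
      (\<Sum>j\<in>J. emeasure (cubeM ({..<m} - {j})) {x \<in> space (cubeM ({..<m} - {j})). 0 < t \<and> t \<le> f (x(j := 1))})" for t
  proof (cases "0 < t")
    case False
    then show ?thesis by simp
  next
    case True
    have "{x. t \<le> g x} = g -` {t..}" by auto
    then have "closed {x. t \<le> g x}"
      using continuous_closed_vimage[of "{t..}" g] g(1) by (simp add: continuous_on_eq_continuous_at)
    then have "closed (S t)"
      unfolding S_def Collect_conj_eq using sja_region_closed by (intro closed_Int) auto
    moreover have "S t \<subseteq> PiE {..<m} (\<lambda>_. {0..1})" using reg by (auto simp: S_def space_cubeM)
    moreover have "x(j := 1) \<in> S t" if "x \<in> S t" "j \<in> J" for x j
      using that up[of x j] sja_region_upd[OF _ J(1), of x p j] by (auto simp: S_def)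
    moreover have "(real m + 1) * (\<Sum>i\<in>L. 1 - x i) \<le> (\<Sum>i\<in>{card J - card L + 1..card J}. sja_lambda m p i)"
      if "x \<in> S t" "L \<subseteq> J" for x L
      using that J p0 by (intro sja_region_SIM) (auto simp: S_def)
    ultimately have "ennreal (real m + 1) * emeasure (cubeM {..<m}) (S t) \<le>
      (\<Sum>j\<in>J. emeasure (cubeM ({..<m} - {j})) {x \<in> space (cubeM ({..<m} - {j})). x(j := 1) \<in> S t})"
      using nodef[OF False] J by (intro nonpos_deficiency_section_bound[where \<alpha> = "sja_lambda m p"]) auto
    moreover have "{x \<in> space (cubeM {..<m}). x \<in> S t} = S t" using reg by (auto simp: S_def)
    ultimately show ?thesis using True by (simp add: f_iff)
  qed
  have "ennreal (real m + 1) * (\<integral>\<^sup>+ x. ennreal (f x) \<partial>cubeM {..<m}) =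
      (\<integral>\<^sup>+ t. ennreal (real m + 1) * emeasure (cubeM {..<m}) {x \<in> space (cubeM {..<m}). 0 < t \<and> t \<le> f x} \<partial>lborel)"
    by (subst nn_integral_layer_cake[OF sf f1], simp, subst nn_integral_cmult[OF measurable_level_emeasure[OF sf f1]]) auto
  also have "\<dots> \<le> (\<integral>\<^sup>+ t. (\<Sum>j\<in>J. emeasure (cubeM ({..<m} - {j})) {x \<in> space (cubeM ({..<m} - {j})). 0 < t \<and> t \<le> f (x(j := 1))}) \<partial>lborel)"
    by (intro nn_integral_mono level)
  also have "\<dots> = (\<Sum>j\<in>J. \<integral>\<^sup>+ t. emeasure (cubeM ({..<m} - {j})) {x \<in> space (cubeM ({..<m} - {j})). 0 < t \<and> t \<le> f (x(j := 1))} \<partial>lborel)"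
    by (rule nn_integral_sum) (rule measurable_level_emeasure[OF sf f2], simp)
  also have "\<dots> = (\<Sum>j\<in>J. \<integral>\<^sup>+ x. ennreal (f (x(j := 1))) \<partial>cubeM ({..<m} - {j}))"
    by (intro sum.cong refl nn_integral_layer_cake[OF sf f2, symmetric]) simp
  finally show ?thesis by (simp add: f_def)
qed

text \<open>Normalization never raises a price, and a bundle whose price it replaces now costs
  \<open>p m\<close>, for which the full bundle is at least as good. So the best attainable surplus
  is the same under both price lists.\<close>

lemma norm_prices_cases:
  assumes J: "J \<subseteq> {..<m}" and x: "x \<in> cube m"
  shows "(\<Sum>j\<in>J. x j) - p (card J) \<le> (\<Sum>j\<in>J. x j) - norm_prices m p (card J)"
    and "(\<Sum>j\<in>J. x j) - norm_prices m p (card J) \<le> (\<Sum>j\<in>J. x j) - p (card J) \<or>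
      J \<noteq> {} \<and> (\<Sum>j\<in>J. x j) - norm_prices m p (card J) \<le> (\<Sum>j\<in>{..<m}. x j) - p (card {..<m})"
proof -
  have "(\<Sum>j\<in>J. x j) \<le> (\<Sum>j\<in>{..<m}. x j)"
    using J x by (intro sum_mono2) (auto simp: cube_def PiE_def Pi_def)
  then show "(\<Sum>j\<in>J. x j) - norm_prices m p (card J) \<le> (\<Sum>j\<in>J. x j) - p (card J) \<or>
      J \<noteq> {} \<and> (\<Sum>j\<in>J. x j) - norm_prices m p (card J) \<le> (\<Sum>j\<in>{..<m}. x j) - p (card {..<m})"
    by (auto simp: norm_prices_def)
  show "(\<Sum>j\<in>J. x j) - p (card J) \<le> (\<Sum>j\<in>J. x j) - norm_prices m p (card J)"
    by (auto simp: norm_prices_def)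
qed

text \<open>Take a nonempty bundle of greatest surplus at the original prices. The affordable
  \<open>K\<close> makes this surplus nonnegative, so the empty bundle is no better, and
  normalization does not change the maximum.\<close>

lemma sja_region_cover:
  assumes m: "m \<ge> 1" and p0: "p 0 = 0" and x: "x \<in> cube m"
    and K: "K \<subseteq> {..<m}" "K \<noteq> {}" "p (card K) \<le> (\<Sum>j\<in>K. x j)"
  shows "\<exists>J. J \<subseteq> {..<m} \<and> J \<noteq> {} \<and> x \<in> sja_region m p J"
proof -
  define f where "f L = (\<Sum>j\<in>L. x j) - p (card L)" for L
  define S where "S = {L. L \<subseteq> {..<m} \<and> L \<noteq> {}}"
  have S: "finite S" "S \<noteq> {}" using K by (auto simp: S_def)
  obtain J where J: "J \<in> S" "\<And>L. L \<in> S \<Longrightarrow> f L \<le> f J"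
  proof -
    have "Max (f ` S) \<in> f ` S" using S by (intro Max_in) auto
    then obtain J where "J \<in> S" "f J = Max (f ` S)" by auto
    with S that show thesis by (metis Max_ge finite_imageI image_eqI)
  qed
  have J': "J \<subseteq> {..<m}" "J \<noteq> {}" using J by (auto simp: S_def)
  have full: "{..<m} \<in> S" using m by (auto simp: S_def lessThan_empty_iff)
  have fJ: "0 \<le> f J" using J(2)[of K] K by (auto simp: S_def f_def)
  have "(\<Sum>j\<in>L. x j) - norm_prices m p (card L) \<le> (\<Sum>j\<in>J. x j) - norm_prices m p (card J)"
    if L: "L \<subseteq> {..<m}" for L
  proof -
    have "(\<Sum>j\<in>L. x j) - norm_prices m p (card L) \<le> f J"
    proof (cases "L = {}")
      case True
      with fJ show ?thesis by (simp add: norm_prices_def p0)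
    next
      case False
      then have "f L \<le> f J" "f {..<m} \<le> f J" using J(2) full L by (auto simp: S_def)
      with norm_prices_cases(2)[OF L x, of p] show ?thesis by (auto simp: f_def)
    qed
    with norm_prices_cases(1)[OF J'(1) x, of p] show ?thesis by (simp add: f_def)
  qed
  with J' x show ?thesis by (auto simp: sja_region_def)
qed

section \<open>Ties between bundles are null events\<close>

lemma AE_subset_sums_no_tie:
  assumes I: "finite I" and J: "J \<subseteq> I" "L \<subseteq> I" "J \<noteq> L"
  shows "AE x in cubeM I. (\<Sum>k\<in>J. x k) - (\<Sum>k\<in>L. x k) \<noteq> c"
proof -
  \<comment> \<open>A tie is a hyperplane whose coefficients are differences of two indicators; some
    coefficient is nonzero because the bundles differ.\<close>
  define d where "d k = (indicator J k - indicator L k :: real)" for k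
  obtain i where i0: "i \<in> J \<and> i \<notin> L \<or> i \<notin> J \<and> i \<in> L" using J(3) by blast
  then have i: "i \<in> I" using J by auto
  have di: "d i \<noteq> 0" using i0 by (auto simp: d_def)
  have sum_ind: "(\<Sum>k\<in>K. x k) = (\<Sum>k\<in>I. indicator K k * x k)"
    if "K \<subseteq> I" for K and x :: "nat \<Rightarrow> real"
  proof -
    have "(\<Sum>k\<in>I. indicator K k * x k) = (\<Sum>k\<in>I \<inter> K. x k)"
      using I by (simp add: sum.inter_restrict indicator_def if_distrib[of "\<lambda>t. t * _"] cong: if_cong)
    also have "I \<inter> K = K" using that by auto
    finally show ?thesis by simp
  qed
  have "(\<Sum>k\<in>J. x k) - (\<Sum>k\<in>L. x k) = (\<Sum>k\<in>I. d k * x k)" for x :: "nat \<Rightarrow> real"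
    by (simp only: sum_ind[OF J(1)] sum_ind[OF J(2)]) (simp add: d_def left_diff_distrib sum_subtractf)
  with AE_cubeM_hyperplane[of I i d c] I i di show ?thesis by simp
qed

lemma AE_no_tie:
  "AE x in cubeM {..<m}. \<forall>J\<in>Pow {..<m}. \<forall>L\<in>Pow {..<m}. J \<noteq> L \<longrightarrow>
     (\<Sum>k\<in>J. x k) - (\<Sum>k\<in>L. x k) \<noteq> c J L"
proof -
  have "AE x in cubeM {..<m}. J \<noteq> L \<longrightarrow> (\<Sum>k\<in>J. x k) - (\<Sum>k\<in>L. x k) \<noteq> c J L"
    if "J \<subseteq> {..<m}" "L \<subseteq> {..<m}" for J L
    using AE_subset_sums_no_tie[OF _ that, of "c J L"] by (cases "J = L") auto
  then show ?thesis by (intro AE_finite_allI) auto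
qed

text \<open>Bundles that differ only in \<open>j\<close> have a constant difference on the face
  \<open>x j = 1\<close> and could tie everywhere, so both are required to contain \<open>j\<close>.
  Removing \<open>j\<close> then keeps them distinct and leaves a tie in the other
  coordinates.\<close>

lemma AE_face_no_tie:
  "AE x in cubeM ({..<m} - {j}). \<forall>J\<in>Pow {..<m}. \<forall>L\<in>Pow {..<m}. j \<in> J \<longrightarrow> j \<in> L \<longrightarrow> J \<noteq> L \<longrightarrow>
     (\<Sum>k\<in>J. (x(j := 1)) k) - (\<Sum>k\<in>L. (x(j := 1)) k) \<noteq> (c J L :: real)"
proof -
  have "AE x in cubeM ({..<m} - {j}). j \<in> J \<longrightarrow> j \<in> L \<longrightarrow> J \<noteq> L \<longrightarrow>
      (\<Sum>k\<in>J. (x(j := 1)) k) - (\<Sum>k\<in>L. (x(j := 1)) k) \<noteq> c J L"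
    if J: "J \<subseteq> {..<m}" "L \<subseteq> {..<m}" for J L
  proof (cases "j \<in> J \<and> j \<in> L \<and> J \<noteq> L")
    case True
    have face_sum: "(\<Sum>k\<in>K. (x(j := 1)) k) = 1 + (\<Sum>k\<in>K - {j}. x k)"
      if "K \<subseteq> {..<m}" "j \<in> K" for K and x :: "nat \<Rightarrow> real"
    proof -
      have K: "finite K" using that(1) by (rule finite_subset) simp
      show ?thesis using sum_fun_upd[OF K, of x j 1] that(2) sum.remove[OF K that(2), of x] by simp
    qed
    have "J - {j} \<noteq> L - {j}" using True by blast
    with J have "AE x in cubeM ({..<m} - {j}). (\<Sum>k\<in>J - {j}. x k) - (\<Sum>k\<in>L - {j}. x k) \<noteq> c J L"
      by (intro AE_subset_sums_no_tie) auto
    then show ?thesis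
      by eventually_elim (use True J in \<open>simp only: face_sum\<close>, simp)
  next
    case False
    then show ?thesis by auto
  qed
  then show ?thesis by (intro AE_finite_allI) auto
qed

text \<open>The region bounds are summed over all nonempty bundles. On the left, the regions cover
  the complement of \<open>Z\<close>. On the right, the regions of bundles containing
  \<open>j\<close> overlap on the face \<open>x j = 1\<close> only in a null set, so together they
  contribute at most the integral of \<open>g\<close> over that face.\<close>

lemma sja_face_bound:
  assumes m: "m \<ge> 1" and p0: "p 0 = 0"
    and nodef: "\<And>J A. J \<subseteq> {..<m} \<Longrightarrow> J \<noteq> {} \<Longrightarrow> sja_region m p J \<noteq> {} \<Longrightarrow> body (card J) A \<Longrightarrow>
       A \<subseteq> SIM_body (card J) (sja_lambda m p) \<Longrightarrow> deficiency 1 (card J) A \<le> 0"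
    and g: "continuous_on UNIV g" "\<And>x. g x \<ge> 0"
    and up: "\<And>J x j. J \<subseteq> {..<m} \<Longrightarrow> x \<in> sja_region m p J \<Longrightarrow> j \<in> J \<Longrightarrow> g x \<le> g (x(j := 1))"
    and Z: "\<And>x. x \<in> cube m \<Longrightarrow> x \<notin> Z \<Longrightarrow> \<exists>J. J \<subseteq> {..<m} \<and> J \<noteq> {} \<and> p (card J) \<le> (\<Sum>j\<in>J. x j)"
  shows "ennreal (real m + 1) * (\<integral>\<^sup>+ x. ennreal (indicator (- Z) x * g x) \<partial>cubeM {..<m}) \<le>
    (\<Sum>j<m. \<integral>\<^sup>+ x. ennreal (g (x(j := 1))) \<partial>cubeM ({..<m} - {j}))"
proof -
  define f where "f J x = ennreal (indicator (sja_region m p J) x * g x)" for J x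
  define P where "P = Pow {..<m} - {{}}"
  have P: "finite P" by (auto simp: P_def)
  have fb: "f J \<in> borel_measurable borel" for J
    unfolding f_def using borel_measurable_continuous_onI[OF g(1)] borel_closed[OF sja_region_closed[of m p J]]
    by measurable
  have f1: "f J \<in> borel_measurable (cubeM I)" for I J
    using measurable_compose[OF measurable_cubeM_borel fb] .
  have f2: "(\<lambda>x. f J (x(j := 1))) \<in> borel_measurable (cubeM I)" for I j J
    using measurable_compose[OF continuous_measurable_cubeM[OF continuous_on_fun_upd] fb] .
  have "ennreal (real m + 1) * (\<integral>\<^sup>+ x. ennreal (indicator (- Z) x * g x) \<partial>cubeM {..<m}) \<le>
      ennreal (real m + 1) * (\<integral>\<^sup>+ x. (\<Sum>J\<in>P. f J x) \<partial>cubeM {..<m})"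
  proof (intro mult_left_mono nn_integral_mono)
    fix x assume "x \<in> space (cubeM {..<m})"
    then have x: "x \<in> cube m" by (simp add: space_cubeM cube_def)
    show "ennreal (indicator (- Z) x * g x) \<le> (\<Sum>J\<in>P. f J x)"
    proof (cases "x \<in> Z")
      case False
      obtain K where "K \<subseteq> {..<m}" "K \<noteq> {}" "p (card K) \<le> (\<Sum>j\<in>K. x j)"
        using Z[OF x False] by blast
      from sja_region_cover[where p = p, OF m p0 x this] obtain J
        where J: "J \<in> P" "x \<in> sja_region m p J"
        unfolding P_def by blast
      then have "ennreal (indicator (- Z) x * g x) = f J x" using False by (simp add: f_def)
      also have "\<dots> \<le> (\<Sum>J\<in>P. f J x)" using P J by (intro member_le_sum) auto
      finally show ?thesis .
    qed simp
  qed simp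
  also have "\<dots> = (\<Sum>J\<in>P. ennreal (real m + 1) * (\<integral>\<^sup>+ x. f J x \<partial>cubeM {..<m}))"
    using f1 by (simp add: nn_integral_sum sum_distrib_left)
  also have "\<dots> \<le> (\<Sum>J\<in>P. \<Sum>j\<in>J. \<integral>\<^sup>+ x. f J (x(j := 1)) \<partial>cubeM ({..<m} - {j}))"
    unfolding f_def
    by (intro sum_mono sja_region_face_bound p0 g) (auto simp: P_def intro: up nodef)
  \<comment> \<open>The sums over bundles and items are exchanged, to collect for each face all
    bundles that contain its item.\<close>
  also have "\<dots> = (\<Sum>J\<in>P. \<Sum>j | j \<in> {..<m} \<and> j \<in> J. \<integral>\<^sup>+ x. f J (x(j := 1)) \<partial>cubeM ({..<m} - {j}))"
    by (intro sum.cong) (auto simp: P_def)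
  also have "\<dots> = (\<Sum>j<m. \<Sum>J | J \<in> P \<and> j \<in> J. \<integral>\<^sup>+ x. f J (x(j := 1)) \<partial>cubeM ({..<m} - {j}))"
    using P by (intro sum.swap_restrict) auto
  also have "\<dots> = (\<Sum>j<m. \<integral>\<^sup>+ x. (\<Sum>J | J \<in> P \<and> j \<in> J. f J (x(j := 1))) \<partial>cubeM ({..<m} - {j}))"
    using f2 by (simp add: nn_integral_sum)
  also have "\<dots> \<le> (\<Sum>j<m. \<integral>\<^sup>+ x. ennreal (g (x(j := 1))) \<partial>cubeM ({..<m} - {j}))"
  proof (intro sum_mono nn_integral_mono_AE)
    fix j assume "j \<in> {..<m}"
    then have j: "j < m" by simp
    show "AE x in cubeM ({..<m} - {j}). (\<Sum>J | J \<in> P \<and> j \<in> J. f J (x(j := 1))) \<le> ennreal (g (x(j := 1)))"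
      using AE_face_no_tie[of m j "\<lambda>J L. norm_prices m p (card J) - norm_prices m p (card L)"]
    proof eventually_elim
      case (elim x)
      define y where "y = x(j := 1)"
      have uniq: "J = L" if "J \<in> P" "j \<in> J" "L \<in> P" "j \<in> L" "y \<in> sja_region m p J" "y \<in> sja_region m p L" for J L
      proof (rule ccontr)
        assume "J \<noteq> L"
        have JL: "J \<subseteq> {..<m}" "L \<subseteq> {..<m}" using that by (auto simp: P_def)
        have "(\<Sum>k\<in>J. y k) - (\<Sum>k\<in>L. y k) = norm_prices m p (card J) - norm_prices m p (card L)"
          using that(5,6) JL unfolding sja_region_def by (smt (verit) mem_Collect_eq)
        with elim \<open>J \<noteq> L\<close> that JL show False unfolding y_def by blast
      qed
      show ?case
      proof (cases "\<exists>J\<in>P. j \<in> J \<and> y \<in> sja_region m p J")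
        case True
        then obtain J where J: "J \<in> P" "j \<in> J" "y \<in> sja_region m p J" by blast
        have "(\<Sum>L | L \<in> P \<and> j \<in> L. f L y) = (\<Sum>L | L \<in> P \<and> j \<in> L. if L = J then ennreal (g y) else 0)"
          using uniq J by (intro sum.cong) (auto simp: f_def indicator_def)
        also have "\<dots> = ennreal (g y)" using J P by simp
        finally show ?thesis by (simp add: y_def)
      next
        case False
        then have "(\<Sum>L | L \<in> P \<and> j \<in> L. f L y) = 0"
          by (intro sum.neutral) (auto simp: f_def indicator_def)
        then show ?thesis by (simp add: y_def)
      qed
    qed
  qed
  finally show ?thesis .
qed

section \<open>Utilities of mechanisms and the revenue formula\<close>

lemma unit_integral_eq:
  fixes f :: "real \<Rightarrow> real"
  assumes "continuous_on {0..1} f"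
  shows "(\<integral>t. f t \<partial>unit_lborel) = integral {0..1} f"
  using set_borel_integral_eq_integral(2)[OF borel_integrable_atLeastAtMost'[OF assms]]
  by (simp add: integral_restrict_space set_lebesgue_integral_def)

text \<open>On \<open>[0, s]\<close> the substitution gives the factor \<open>s\<close>; on
  \<open>[s, 1]\<close> the argument \<open>t / s\<close> is at least 1, where \<open>f\<close> is
  constant.\<close>

lemma unit_integral_stretch:
  fixes f :: "real \<Rightarrow> real"
  assumes f: "continuous_on UNIV f" and s: "0 < s" "s < 1" and const: "\<And>t. 1 \<le> t \<Longrightarrow> f t = f 1"
  shows "(\<integral>t. f (t / s) \<partial>unit_lborel) = s * (\<integral>t. f t \<partial>unit_lborel) + (1 - s) * f 1"
proof -
  have c1: "continuous_on A f" for A using f continuous_on_subset by blast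
  have c2: "continuous_on A (\<lambda>t. f (t / s))" for A
    using s by (intro continuous_on_compose2[OF f] continuous_intros) auto
  have im: "(\<lambda>x. x / (1 / s)) ` {0..1} = {0..s}"
  proof -
    have "(\<lambda>x. x / (1 / s)) ` {0..1} = (*) s ` {0..1}" by (intro image_cong) auto
    then show ?thesis using s image_mult_atLeastAtMost[of s 0 1] by simp
  qed
  have "integral {0..s} (\<lambda>t. f (t / s)) = s * integral {0..1} f"
    using integral_stretch_real[of "1 / s" 0 1 f] s im by simp
  moreover have "integral {s..1} (\<lambda>t. f (t / s)) = integral {s..1} (\<lambda>t. f 1)"
    using s by (intro integral_cong const) (auto simp: field_simps)
  moreover have "integral {0..1} (\<lambda>t. f (t / s)) =
      integral {0..s} (\<lambda>t. f (t / s)) + integral {s..1} (\<lambda>t. f (t / s))"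
    using s c2 by (intro Henstock_Kurzweil_Integration.integral_combine[symmetric] integrable_continuous_interval) auto
  ultimately show ?thesis using s by (simp add: unit_integral_eq c1 c2)
qed

text \<open>The integral of \<open>f (s * t)\<close> is that of \<open>f\<close> over
  \<open>[0, s]\<close> divided by \<open>s\<close>, and on the remaining piece
  \<open>[s, 1]\<close> the slope condition bounds \<open>f\<close> from below.\<close>

lemma unit_integral_shrink:
  fixes f :: "real \<Rightarrow> real"
  assumes f: "continuous_on UNIV f" and s: "0 < s" "s < 1"
    and lip: "\<And>t. 0 \<le> t \<Longrightarrow> t \<le> 1 \<Longrightarrow> f 1 - (1 - t) \<le> f t"
  shows "(\<integral>t. f (s * t) \<partial>unit_lborel) \<le> ((\<integral>t. f t \<partial>unit_lborel) - (1 - s) * (f 1 - (1 - s))) / s"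
proof -
  have c1: "continuous_on A f" for A using f continuous_on_subset by blast
  have c2: "continuous_on A (\<lambda>t. f (s * t))" for A
    by (intro continuous_on_compose2[OF f] continuous_intros) auto
  have im: "(\<lambda>x. x / s) ` {0..s} = {0..1}"
    using s image_divide_atLeastAtMost[of s 0 s] by simp
  have "integral {0..1} (\<lambda>t. f (s * t)) = integral {0..s} f / s"
    using integral_stretch_real[of s 0 s f] s im by simp
  moreover have "integral {s..1} (\<lambda>t. f 1 - (1 - s)) \<le> integral {s..1} f"
  proof (intro integral_le integrable_continuous_interval c1 continuous_intros)
    fix t assume "t \<in> {s..1}"
    with lip[of t] s show "f 1 - (1 - s) \<le> f t" by auto
  qed
  moreover have "integral {0..1} f = integral {0..s} f + integral {s..1} f"
    using s c1 by (intro Henstock_Kurzweil_Integration.integral_combine[symmetric] integrable_continuous_interval) auto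
  ultimately have "integral {0..s} f \<le> integral {0..1} f - (1 - s) * (f 1 - (1 - s))"
    using s by simp
  with s \<open>integral {0..1} (\<lambda>t. f (s * t)) = integral {0..s} f / s\<close> show ?thesis
    by (simp add: unit_integral_eq c1 c2 divide_right_mono)
qed

section \<open>Integrability and Fubini on the cube\<close>

lemma bounded_on_cube:
  fixes f :: "(nat \<Rightarrow> real) \<Rightarrow> real"
  assumes "continuous_on UNIV f"
  obtains B where "\<And>x. x \<in> PiE I (\<lambda>_. {0..1}) \<Longrightarrow> \<bar>f x\<bar> \<le> B"
proof -
  have "compact (f ` PiE I (\<lambda>_. {0..1}))"
    using continuous_on_subset[OF assms] by (intro compact_continuous_image compact_PiE_real) auto
  then have "bounded (f ` PiE I (\<lambda>_. {0..1}))" by (rule compact_imp_bounded)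
  with that show thesis by (auto simp: bounded_iff)
qed

lemma integrable_cubeM:
  fixes f :: "(nat \<Rightarrow> real) \<Rightarrow> real"
  assumes "finite I" "continuous_on UNIV f"
  shows "integrable (cubeM I) f"
proof -
  interpret prob_space "cubeM I" using assms(1) by (rule prob_space_cubeM)
  obtain B where "\<And>x. x \<in> PiE I (\<lambda>_. {0..1}) \<Longrightarrow> \<bar>f x\<bar> \<le> B" using bounded_on_cube[OF assms(2)] by blast
  then show ?thesis
    using continuous_measurable_cubeM[OF assms(2)]
    by (intro integrable_const_bound[where B = B]) (auto simp: space_cubeM)
qed

lemma integral_cubeM_coordinate:
  fixes f :: "(nat \<Rightarrow> real) \<Rightarrow> real"
  assumes "j < m" and f: "integrable (cubeM {..<m}) f"
  shows "integral\<^sup>L (cubeM {..<m}) f = (\<integral>x. (\<integral>t. f (x(j := t)) \<partial>unit_lborel) \<partial>cubeM ({..<m} - {j}))"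
proof -
  have "insert j ({..<m} - {j}) = {..<m}" using assms by auto
  then show ?thesis using cube.product_integral_insert[of "{..<m} - {j}" j f] f by simp
qed

lemma integrable_cubeM_coordinate:
  fixes f :: "(nat \<Rightarrow> real) \<Rightarrow> real"
  assumes j: "j < m" and f: "continuous_on UNIV f"
  shows "integrable (cubeM ({..<m} - {j})) (\<lambda>x. \<integral>t. f (x(j := t)) \<partial>unit_lborel)"
proof -
  have ins: "insert j ({..<m} - {j}) = {..<m}" using j by auto
  interpret prob_space "cubeM ({..<m} - {j})" by (rule prob_space_cubeM) simp
  obtain B where B: "\<And>x. x \<in> PiE {..<m} (\<lambda>_. {0..1}) \<Longrightarrow> \<bar>f x\<bar> \<le> B" using bounded_on_cube[OF f] by blast
  have meas: "(\<lambda>(x, t). f (x(j := t))) \<in> borel_measurable (cubeM ({..<m} - {j}) \<Otimes>\<^sub>M unit_lborel)"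
    using measurable_compose[OF measurable_add_dim[of j "{..<m} - {j}" "\<lambda>_. unit_lborel"], unfolded ins,
        OF continuous_measurable_cubeM[OF f]]
    by (simp add: case_prod_unfold)
  show ?thesis
  proof (rule integrable_const_bound[where B = B])
    show "(\<lambda>x. \<integral>t. f (x(j := t)) \<partial>unit_lborel) \<in> borel_measurable (cubeM ({..<m} - {j}))"
      using meas by (rule unit.borel_measurable_lebesgue_integral)
    show "AE x in cubeM ({..<m} - {j}). norm (\<integral>t. f (x(j := t)) \<partial>unit_lborel) \<le> B"
    proof (rule AE_I2)
      fix x assume x: "x \<in> space (cubeM ({..<m} - {j}))"
      have bd: "\<bar>f (x(j := t))\<bar> \<le> B" if "t \<in> space unit_lborel" for t
        using x that j by (intro B) (auto simp: space_cubeM space_restrict_space PiE_def Pi_def extensional_def)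
      have "norm (\<integral>t. f (x(j := t)) \<partial>unit_lborel) \<le> (\<integral>t. norm (f (x(j := t))) \<partial>unit_lborel)"
        by (rule integral_norm_bound)
      also have "\<dots> \<le> (\<integral>t. B \<partial>unit_lborel)"
      proof (rule integral_mono)
        have "(\<lambda>t. f (x(j := t))) \<in> borel_measurable unit_lborel"
          using measurable_compose[OF measurable_Pair1'[OF x] meas] by simp
        then show "integrable unit_lborel (\<lambda>t. norm (f (x(j := t))))"
          using bd by (intro integrable_norm unit.integrable_const_bound[where B = B]) auto
      qed (use bd in auto)
      also have "\<dots> = B" using unit.prob_space by simp
      finally show "norm (\<integral>t. f (x(j := t)) \<partial>unit_lborel) \<le> B" .
    qed
  qed
qed

text \<open>Utilities are only constrained on the cube; composing with \<open>clip\<close> makes them continuous everywhere.\<close>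

definition clip :: "nat \<Rightarrow> (nat \<Rightarrow> real) \<Rightarrow> (nat \<Rightarrow> real)" where
  "clip m x = (\<lambda>i\<in>{..<m}. max 0 (min 1 (x i)))"

definition utility :: "nat \<Rightarrow> ((nat \<Rightarrow> real) \<Rightarrow> (nat \<Rightarrow> real)) \<Rightarrow> ((nat \<Rightarrow> real) \<Rightarrow> real) \<Rightarrow> (nat \<Rightarrow> real) \<Rightarrow> real" where
  "utility m a p x = dotp m (a x) x - p x"

lemma clip_in_cube [simp]: "clip m x \<in> cube m"
  by (auto simp: clip_def cube_def)

lemma clip_id: "x \<in> cube m \<Longrightarrow> clip m x = x"
  by (auto simp: clip_def cube_def fun_eq_iff PiE_def Pi_def extensional_def)

lemma cube_upd: "x \<in> cube m \<Longrightarrow> j < m \<Longrightarrow> 0 \<le> t \<Longrightarrow> t \<le> 1 \<Longrightarrow> x(j := t) \<in> cube m"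
  by (auto simp: cube_def PiE_def Pi_def extensional_def)

text \<open>The allocation is a subgradient of the utility: type \<open>x\<close> may report
  \<open>y\<close>.\<close>

lemma utility_diff_le:
  assumes "is_IC m a p" "x \<in> cube m" "y \<in> cube m"
  shows "utility m a p y - utility m a p x \<le> (\<Sum>i<m. a y i * (y i - x i))"
proof -
  have "dotp m (a y) x - p y \<le> dotp m (a x) x - p x" using assms by (auto simp: is_IC_def)
  then show ?thesis by (simp add: utility_def dotp_def sum_subtractf right_diff_distrib)
qed

text \<open>The subgradient inequality at both endpoints bounds the increment along one coordinate
  from above and from below.\<close>

lemma utility_upd_diff:
  assumes IC: "is_IC m a p" and x: "x \<in> cube m" and j: "j < m" and t: "0 \<le> t" "t \<le> 1"
  shows "utility m a p (x(j := t)) - utility m a p x \<le> a (x(j := t)) j * (t - x j)"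
    and "a x j * (t - x j) \<le> utility m a p (x(j := t)) - utility m a p x"
proof -
  have y: "x(j := t) \<in> cube m" by (intro cube_upd x j t)
  have 1: "(\<Sum>i<m. b i * ((x(j := t)) i - x i)) = b j * (t - x j)" for b :: "nat \<Rightarrow> real"
    using j by (subst sum.remove[of _ j]) auto
  have 2: "(\<Sum>i<m. b i * (x i - (x(j := t)) i)) = b j * (x j - t)" for b :: "nat \<Rightarrow> real"
    using j by (subst sum.remove[of _ j]) auto
  show "utility m a p (x(j := t)) - utility m a p x \<le> a (x(j := t)) j * (t - x j)"
    using utility_diff_le[OF IC x y] by (simp only: 1)
  show "a x j * (t - x j) \<le> utility m a p (x(j := t)) - utility m a p x"
    using utility_diff_le[OF IC y x] by (simp only: 2) (simp add: algebra_simps)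
qed

text \<open>Slopes between 0 and 1 make the utility 1-Lipschitz for the sum of the coordinate
  distances, and clipping expands no coordinate.\<close>

lemma continuous_utility_clip:
  assumes IC: "is_IC m a p" and alloc: "is_alloc m a"
  shows "continuous_on UNIV (\<lambda>x. utility m a p (clip m x))"
proof -
  define v where "v x = utility m a p (clip m x)" for x
  have le: "v y - v x \<le> (\<Sum>i<m. \<bar>y i - x i\<bar>)" for x y
  proof -
    have "v y - v x \<le> (\<Sum>i<m. a (clip m y) i * (clip m y i - clip m x i))"
      unfolding v_def by (intro utility_diff_le IC) auto
    also have "\<dots> \<le> (\<Sum>i<m. \<bar>y i - x i\<bar>)"
    proof (rule sum_mono)
      fix i assume i: "i \<in> {..<m}"
      have ai: "0 \<le> a (clip m y) i" "a (clip m y) i \<le> 1"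
        using alloc i by (auto simp: is_alloc_def)
      have "a (clip m y) i * (clip m y i - clip m x i) \<le> a (clip m y) i * \<bar>clip m y i - clip m x i\<bar>"
        using ai by (intro mult_left_mono) auto
      also have "\<dots> \<le> 1 * \<bar>clip m y i - clip m x i\<bar>"
        using ai by (intro mult_right_mono) auto
      also have "\<dots> \<le> \<bar>y i - x i\<bar>" using i by (auto simp: clip_def)
      finally show "a (clip m y) i * (clip m y i - clip m x i) \<le> \<bar>y i - x i\<bar>" .
    qed
    finally show ?thesis .
  qed
  have lip: "\<bar>v y - v x\<bar> \<le> (\<Sum>i<m. \<bar>y i - x i\<bar>)" for x y
    using le[of y x] le[of x y] by (simp add: abs_minus_commute)
  \<comment> \<open>The topology is the product topology, so the bound tends to 0 because each of
    the finitely many coordinates in it is continuous.\<close>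
  have "(v \<longlongrightarrow> v x) (at x)" for x
  proof (subst Lim_null, rule Lim_null_comparison)
    show "\<forall>\<^sub>F y in at x. norm (v y - v x) \<le> (\<Sum>i<m. \<bar>y i - x i\<bar>)"
      using lip by simp
    have "((\<lambda>y. y i) \<longlongrightarrow> x i) (at x)" for i
      using continuous_on_product_coordinates[of i, unfolded continuous_on_def] by auto
    then have "((\<lambda>y. \<Sum>i<m. \<bar>y i - x i\<bar>) \<longlongrightarrow> (\<Sum>i<m. \<bar>x i - x i\<bar>)) (at x)"
      by (intro tendsto_intros)
    then show "((\<lambda>y. \<Sum>i<m. \<bar>y i - x i\<bar>) \<longlongrightarrow> 0) (at x)" by simp
  qed
  then show ?thesis by (simp add: continuous_on_def flip: v_def)
qed

section \<open>Rescaling one coordinate\<close>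

lemma continuous_on_coordinate_map:
  assumes "continuous_on UNIV h"
  shows "continuous_on UNIV (\<lambda>x::nat \<Rightarrow> real. x(j := h (x j)))"
proof (rule continuous_on_coordinatewise_then_product)
  fix i show "continuous_on UNIV (\<lambda>x. (x(j := h (x j))) i)"
    by (cases "i = j") (auto intro!: continuous_on_compose2[OF assms])
qed

lemma continuous_on_upd_arg: "continuous_on UNIV (\<lambda>t. x(j := t) :: nat \<Rightarrow> real)"
proof (rule continuous_on_coordinatewise_then_product)
  fix i show "continuous_on UNIV (\<lambda>t. (x(j := t)) i)"
    by (cases "i = j") (auto intro!: continuous_intros)
qed

text \<open>Stretching coordinate \<open>j\<close> changes the integral by \<open>1 - s\<close>
  times the face integral minus the cube integral, which is what integration by parts of
  \<open>x j\<close> times the partial derivative would predict.\<close>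

lemma integral_coordinate_stretch:
  fixes v :: "(nat \<Rightarrow> real) \<Rightarrow> real"
  assumes v: "continuous_on UNIV v" and j: "j < m" and s: "0 < s" "s < 1"
    and const: "\<And>x t. 1 \<le> t \<Longrightarrow> v (x(j := t)) = v (x(j := 1))"
  shows "(\<integral>x. v (x(j := x j / s)) \<partial>cubeM {..<m}) =
    s * integral\<^sup>L (cubeM {..<m}) v + (1 - s) * (\<integral>x. v (x(j := 1)) \<partial>cubeM ({..<m} - {j}))"
proof -
  have c: "continuous_on UNIV (\<lambda>x::nat \<Rightarrow> real. v (x(j := x j / s)))"
    using s by (intro continuous_on_compose2[OF v] continuous_on_coordinate_map continuous_intros) auto
  have c1: "continuous_on UNIV (\<lambda>x. v (x(j := 1)))"
    by (intro continuous_on_compose2[OF v continuous_on_fun_upd]) auto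
  have "(\<integral>x. v (x(j := x j / s)) \<partial>cubeM {..<m}) =
      (\<integral>x. (\<integral>t. v (x(j := t / s)) \<partial>unit_lborel) \<partial>cubeM ({..<m} - {j}))"
    using integral_cubeM_coordinate[OF j integrable_cubeM[OF _ c]] by simp
  also have "\<dots> = (\<integral>x. s * (\<integral>t. v (x(j := t)) \<partial>unit_lborel) + (1 - s) * v (x(j := 1)) \<partial>cubeM ({..<m} - {j}))"
  proof (rule Bochner_Integration.integral_cong[OF refl])
    fix x
    have "continuous_on UNIV (\<lambda>t. v (x(j := t)))"
      by (rule continuous_on_compose2[OF v continuous_on_upd_arg]) simp
    from unit_integral_stretch[OF this s const]
    show "(\<integral>t. v (x(j := t / s)) \<partial>unit_lborel) =
      s * (\<integral>t. v (x(j := t)) \<partial>unit_lborel) + (1 - s) * v (x(j := 1))" by simp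
  qed
  also have "\<dots> = s * (\<integral>x. (\<integral>t. v (x(j := t)) \<partial>unit_lborel) \<partial>cubeM ({..<m} - {j})) +
      (1 - s) * (\<integral>x. v (x(j := 1)) \<partial>cubeM ({..<m} - {j}))"
    using integrable_cubeM_coordinate[OF j v] integrable_cubeM[OF _ c1, of "{..<m} - {j}"] by simp
  also have "(\<integral>x. (\<integral>t. v (x(j := t)) \<partial>unit_lborel) \<partial>cubeM ({..<m} - {j})) = integral\<^sup>L (cubeM {..<m}) v"
    using integral_cubeM_coordinate[OF j integrable_cubeM[OF _ v]] by simp
  finally show ?thesis .
qed

text \<open>The counterpart in the opposite direction. Here the face integral enters through an
  estimate, as \<open>v\<close> on the strip next to the face is controlled from below only up to
  \<open>1 - s\<close>.\<close>

lemma integral_coordinate_shrink: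
  fixes v :: "(nat \<Rightarrow> real) \<Rightarrow> real"
  assumes v: "continuous_on UNIV v" and j: "j < m" and s: "0 < s" "s < 1"
    and lip: "\<And>x t. 0 \<le> t \<Longrightarrow> t \<le> 1 \<Longrightarrow> v (x(j := 1)) - (1 - t) \<le> v (x(j := t))"
  shows "(\<integral>x. v (x(j := s * x j)) \<partial>cubeM {..<m}) \<le>
    (integral\<^sup>L (cubeM {..<m}) v - (1 - s) * ((\<integral>x. v (x(j := 1)) \<partial>cubeM ({..<m} - {j})) - (1 - s))) / s"
proof -
  interpret prob_space "cubeM ({..<m} - {j})" by (rule prob_space_cubeM) simp
  have c: "continuous_on UNIV (\<lambda>x::nat \<Rightarrow> real. v (x(j := s * x j)))"
    by (intro continuous_on_compose2[OF v] continuous_on_coordinate_map continuous_intros) auto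
  have c1: "continuous_on UNIV (\<lambda>x. v (x(j := 1)))"
    by (intro continuous_on_compose2[OF v continuous_on_fun_upd]) auto
  have int: "integrable (cubeM ({..<m} - {j})) (\<lambda>x. \<integral>t. v (x(j := t)) \<partial>unit_lborel)"
    "integrable (cubeM ({..<m} - {j})) (\<lambda>x. v (x(j := 1)))"
    using integrable_cubeM_coordinate[OF j v] integrable_cubeM[OF _ c1, of "{..<m} - {j}"] by auto
  have "(\<integral>x. v (x(j := s * x j)) \<partial>cubeM {..<m}) =
      (\<integral>x. (\<integral>t. v (x(j := s * t)) \<partial>unit_lborel) \<partial>cubeM ({..<m} - {j}))"
    using integral_cubeM_coordinate[OF j integrable_cubeM[OF _ c]] by simp
  also have "\<dots> \<le> (\<integral>x. ((\<integral>t. v (x(j := t)) \<partial>unit_lborel) - (1 - s) * (v (x(j := 1)) - (1 - s))) / s \<partial>cubeM ({..<m} - {j}))"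
  proof (rule integral_mono)
    show "integrable (cubeM ({..<m} - {j})) (\<lambda>x. \<integral>t. v (x(j := s * t)) \<partial>unit_lborel)"
      using integrable_cubeM_coordinate[OF j c] by simp
    show "(\<integral>t. v (x(j := s * t)) \<partial>unit_lborel) \<le> ((\<integral>t. v (x(j := t)) \<partial>unit_lborel) - (1 - s) * (v (x(j := 1)) - (1 - s))) / s" for x
      using s lip by (intro unit_integral_shrink continuous_on_compose2[OF v continuous_on_upd_arg]) auto
  qed (use int in auto)
  also have "\<dots> = ((\<integral>x. (\<integral>t. v (x(j := t)) \<partial>unit_lborel) \<partial>cubeM ({..<m} - {j})) -
      (1 - s) * ((\<integral>x. v (x(j := 1)) \<partial>cubeM ({..<m} - {j})) - (1 - s))) / s"
    using int by (simp add: prob_space)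
  also have "(\<integral>x. (\<integral>t. v (x(j := t)) \<partial>unit_lborel) \<partial>cubeM ({..<m} - {j})) = integral\<^sup>L (cubeM {..<m}) v"
    using integral_cubeM_coordinate[OF j integrable_cubeM[OF _ v]] by simp
  finally show ?thesis .
qed

text \<open>The slab where division by \<open>s\<close> leaves the cube; its mass vanishes as
  \<open>s\<close> tends to 1.\<close>

lemma integral_cubeM_slab:
  assumes j: "j < m" and s: "0 < s" "s < 1"
  shows "integrable (cubeM {..<m}) (\<lambda>x. indicator {s<..} (x j) :: real)"
    and "(\<integral>x. indicator {s<..} (x j) \<partial>cubeM {..<m}) = 1 - s"
proof -
  interpret M: prob_space "cubeM {..<m}" by (rule prob_space_cubeM) simp
  interpret Mj: prob_space "cubeM ({..<m} - {j})" by (rule prob_space_cubeM) simp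
  have meas: "(\<lambda>x. x j) \<in> borel_measurable (cubeM {..<m})"
    by (rule continuous_measurable_cubeM) simp
  show int: "integrable (cubeM {..<m}) (\<lambda>x. indicator {s<..} (x j) :: real)"
    using meas by (intro M.integrable_const_bound[where B = 1]) auto
  have "(\<integral>x. indicator {s<..} (x j) \<partial>cubeM {..<m}) =
      (\<integral>x. (\<integral>t. indicator {s<..} t \<partial>unit_lborel) \<partial>cubeM ({..<m} - {j}) :: real)"
    using integral_cubeM_coordinate[OF j int] by (simp only: fun_upd_same)
  also have "(\<integral>t. indicator {s<..} t \<partial>unit_lborel) = (1 - s :: real)"
  proof -
    have "indicator {0..1} t *\<^sub>R indicator {s<..} t = (indicator {s<..1} t :: real)" for t
      using s by (auto simp: indicator_def)
    then have "(\<integral>t. indicator {s<..} t \<partial>unit_lborel) = (\<integral>t. indicator {s<..1} t \<partial>lborel :: real)"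
      by (subst integral_restrict_space) (simp_all only: sets_lborel space_lborel space_borel Int_UNIV_right atLeastAtMost_borel)
    then show ?thesis using s by simp
  qed
  finally show "(\<integral>x. indicator {s<..} (x j) \<partial>cubeM {..<m}) = 1 - s" by (simp add: Mj.prob_space)
qed

lemma le_if_le_near_1:
  fixes A B :: real and f :: "real \<Rightarrow> real"
  assumes lim: "(f \<longlongrightarrow> B) (at_left 1)" and le: "\<And>s. 0 < s \<Longrightarrow> s < 1 \<Longrightarrow> A \<le> f s"
  shows "A \<le> B"
proof (rule tendsto_lowerbound[OF lim])
  show "\<forall>\<^sub>F s in at_left 1. A \<le> f s"
    by (rule eventually_at_leftI[of 0]) (use le in auto)
qed simp

text \<open>Formally \<open>a x j\<close> is the partial derivative of \<open>v\<close> in direction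
  \<open>j\<close>, so integration by parts turns the integral of \<open>a x j * x j\<close> into
  the face integral minus the integral of \<open>v\<close>. With the term \<open>- v x\<close> of
  the payment, the \<open>m\<close> directions give the coefficient \<open>m + 1\<close>.\<close>

lemma revenue_formula:
  assumes alloc: "is_alloc m a" and IC: "is_IC m a p" and meas: "p \<in> borel_measurable (completion (unifM m))"
  defines "v \<equiv> \<lambda>x. utility m a p (clip m x)"
  shows "revenue m p = (\<Sum>j<m. \<integral>x. v (x(j := 1)) \<partial>cubeM ({..<m} - {j})) - (real m + 1) * integral\<^sup>L (cubeM {..<m}) v"
proof -
  define I where "I = integral\<^sup>L (cubeM {..<m}) v"
  define F where "F j = (\<integral>x. v (x(j := 1)) \<partial>cubeM ({..<m} - {j}))" for j
  interpret M: prob_space "cubeM {..<m}" by (rule prob_space_cubeM) simp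
  interpret C: prob_space "completion (cubeM {..<m})" by (rule M.prob_space_completion)
  have v: "continuous_on UNIV v" unfolding v_def by (rule continuous_utility_clip[OF IC alloc])
  have vc: "v x = utility m a p x" if "x \<in> cube m" for x using that by (simp add: v_def clip_id)
  have sp: "space (cubeM {..<m}) = cube m" by (simp add: space_cubeM cube_def)
  have p_eq: "p x = (\<Sum>j<m. a x j * x j) - v x" if "x \<in> cube m" for x
    using vc[OF that] by (simp add: utility_def dotp_def)
  have a01: "0 \<le> a x j" "a x j \<le> 1" if "x \<in> cube m" "j < m" for x j
    using alloc that by (auto simp: is_alloc_def)
  have x01: "0 \<le> x j" "x j \<le> 1" if "x \<in> cube m" "j < m" for x j
    using that by (auto simp: cube_def PiE_def Pi_def)
  have ax01: "0 \<le> a x j * x j" "a x j * x j \<le> 1" if "x \<in> cube m" "j < m" for x j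
    using a01[OF that] x01[OF that] by (auto simp: mult_le_one)
  obtain B where B: "\<And>x. x \<in> cube m \<Longrightarrow> \<bar>v x\<bar> \<le> B"
    using bounded_on_cube[OF v, of "{..<m}"] unfolding cube_def by blast
  have intp: "integrable (completion (cubeM {..<m})) p"
  proof (rule C.integrable_const_bound[where B = "real m + B"])
    show "AE x in completion (cubeM {..<m}). norm (p x) \<le> real m + B"
    proof (rule AE_I2)
      fix x assume "x \<in> space (completion (cubeM {..<m}))"
      then have x: "x \<in> cube m" by (simp add: sp)
      have "(\<Sum>j<m. a x j * x j) \<le> (\<Sum>j<m. 1)" using ax01(2)[OF x] by (intro sum_mono) auto
      moreover have "0 \<le> (\<Sum>j<m. a x j * x j)" using ax01(1)[OF x] by (intro sum_nonneg) auto
      ultimately show "norm (p x) \<le> real m + B" using p_eq[OF x] B[OF x] by auto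
    qed
    show "p \<in> borel_measurable (completion (cubeM {..<m}))" using meas by (simp add: unifM_def)
  qed
  have const: "v (x(j := t)) = v (x(j := 1))" if "1 \<le> t" for x j t
  proof -
    have "clip m (x(j := t)) = clip m (x(j := 1))" using that by (auto simp: clip_def fun_eq_iff)
    then show ?thesis by (simp add: v_def)
  qed
  \<comment> \<open>Clipping reduces this to a point \<open>y\<close> of the cube with
    \<open>y j = t\<close>, where the allocation bounds the slope by 1.\<close>
  have lip: "v (x(j := 1)) - (1 - t) \<le> v (x(j := t))" if j: "j < m" and t: "0 \<le> t" "t \<le> 1" for x j t
  proof -
    define y where "y = clip m (x(j := t))"
    have y: "y \<in> cube m" by (simp add: y_def)
    have yj: "y j = t" using j t by (simp add: y_def clip_def)
    have y1: "clip m (x(j := 1)) = y(j := 1)" using j by (auto simp: y_def clip_def fun_eq_iff)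
    have y1c: "y(j := 1) \<in> cube m" by (intro cube_upd y j) auto
    have "utility m a p (y(j := 1)) - utility m a p y \<le> a (y(j := 1)) j * (1 - t)"
      using utility_upd_diff(1)[OF IC y j, of 1] yj by simp
    also have "\<dots> \<le> 1 * (1 - t)" using a01[OF y1c j] t by (intro mult_right_mono) auto
    finally show ?thesis by (simp add: v_def y1) (simp add: y_def)
  qed
  have cs1: "continuous_on UNIV (\<lambda>x::nat \<Rightarrow> real. v (x(j := x j / s)))" if "0 < s" for j s
    using that by (intro continuous_on_compose2[OF v] continuous_on_coordinate_map continuous_intros) auto
  have cs2: "continuous_on UNIV (\<lambda>x::nat \<Rightarrow> real. v (x(j := s * x j)))" for j s
    by (intro continuous_on_compose2[OF v] continuous_on_coordinate_map continuous_intros) auto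
  have intv: "integrable (cubeM {..<m}) v" by (rule integrable_cubeM[OF _ v]) simp
  have int1: "integrable (cubeM {..<m}) (\<lambda>x. v (x(j := x j / s)))" if "0 < s" for j s
    using cs1[OF that] by (intro integrable_cubeM) auto
  have int2: "integrable (cubeM {..<m}) (\<lambda>x. v (x(j := s * x j)))" for j s
    using cs2 by (intro integrable_cubeM) auto
  \<comment> \<open>\<open>a\<close> need not be measurable, so \<open>a x j * x j\<close> is bounded by difference quotients of \<open>v\<close>
    along \<open>x j \<mapsto> x j / s\<close> and \<open>x j \<mapsto> s * x j\<close>, and \<open>s\<close> tends to 1.\<close>
  have upper: "integral\<^sup>L (completion (cubeM {..<m})) p \<le> (\<Sum>j<m. s * (F j - I) + (1 - s)) - I"
    if s: "0 < s" "s < 1" for s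
  proof -
    \<comment> \<open>Where \<open>x j \<le> s\<close>, the move from \<open>x j\<close> to
      \<open>x j / s\<close> has length \<open>x j * (1 - s) / s\<close>, so the weight
      \<open>s / (1 - s)\<close> turns the increment of \<open>v\<close> into an upper bound for
      \<open>a x j * x j\<close>. On the slab \<open>x j > s\<close> the trivial bound 1 is
      charged.\<close>
    define G where "G x = (\<Sum>j<m. s / (1 - s) * (v (x(j := x j / s)) - v x) + indicator {s<..} (x j)) - v x" for x
    have slab: "integrable (cubeM {..<m}) (\<lambda>x. indicator {s<..} (x j) :: real)" if "j < m" for j
      using integral_cubeM_slab(1)[OF that s] .
    have intG: "integrable (cubeM {..<m}) G"
      unfolding G_def using slab int1[OF s(1)] intv
      by (intro Bochner_Integration.integrable_diff Bochner_Integration.integrable_sum Bochner_Integration.integrable_add integrable_mult_right) auto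
    have "integral\<^sup>L (completion (cubeM {..<m})) p \<le> integral\<^sup>L (completion (cubeM {..<m})) G"
    proof (rule integral_mono[OF intp])
      show "integrable (completion (cubeM {..<m})) G"
        using intG by (subst integrable_completion) (auto intro: borel_measurable_integrable)
      fix x assume "x \<in> space (completion (cubeM {..<m}))"
      then have x: "x \<in> cube m" by (simp add: sp)
      have "a x j * x j \<le> s / (1 - s) * (v (x(j := x j / s)) - v x) + indicator {s<..} (x j)" if j: "j < m" for j
      proof (cases "x j \<le> s")
        case True
        have xs: "0 \<le> x j / s" "x j / s \<le> 1" using True s x01[OF x j] by auto
        have "a x j * (x j / s - x j) \<le> v (x(j := x j / s)) - v x"
          using utility_upd_diff(2)[OF IC x j xs] vc[OF x] vc[OF cube_upd[OF x j xs]] by simp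
        then have "s / (1 - s) * (a x j * (x j / s - x j)) \<le> s / (1 - s) * (v (x(j := x j / s)) - v x)"
          using s by (intro mult_left_mono) auto
        moreover have "s / (1 - s) * (a x j * (x j / s - x j)) = a x j * x j"
          using s by (simp add: field_simps)
        ultimately show ?thesis using True by simp
      next
        case False
        have "v (x(j := x j / s)) = v (x(j := 1))" using False s by (intro const) (auto simp: field_simps)
        moreover have "0 \<le> a x j * (1 - x j)" using a01[OF x j] x01[OF x j] by auto
        moreover have "a x j * (1 - x j) \<le> v (x(j := 1)) - v x"
          using utility_upd_diff(2)[OF IC x j, of 1] vc[OF x] vc[OF cube_upd[OF x j, of 1]] by simp
        ultimately have "0 \<le> s / (1 - s) * (v (x(j := x j / s)) - v x)" using s by auto
        with ax01[OF x j] False show ?thesis by auto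
      qed
      then show "p x \<le> G x" unfolding p_eq[OF x] G_def by (intro diff_right_mono sum_mono) auto
    qed
    \<comment> \<open>\<open>G\<close> is measurable before completion, so its integral can be
      computed on the product measure, one coordinate at a time.\<close>
    also have "\<dots> = integral\<^sup>L (cubeM {..<m}) G"
      using intG by (intro integral_completion) (auto intro: borel_measurable_integrable)
    also have "\<dots> = (\<Sum>j<m. s / (1 - s) * ((s * I + (1 - s) * F j) - I) + (1 - s)) - I"
    proof -
      have "integral\<^sup>L (cubeM {..<m}) G = (\<Sum>j<m. s / (1 - s) * ((\<integral>x. v (x(j := x j / s)) \<partial>cubeM {..<m}) - I) +
          (\<integral>x. indicator {s<..} (x j) \<partial>cubeM {..<m})) - I"
      proof -
        have i1: "integrable (cubeM {..<m}) (\<lambda>x. s / (1 - s) * (v (x(j := x j / s)) - v x))" for j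
          using int1[OF s(1)] intv by (intro integrable_mult_right Bochner_Integration.integrable_diff)
        have "integral\<^sup>L (cubeM {..<m}) G =
            (\<integral>x. (\<Sum>j<m. s / (1 - s) * (v (x(j := x j / s)) - v x) + indicator {s<..} (x j)) \<partial>cubeM {..<m}) - I"
          unfolding G_def I_def using slab i1 intv
          by (intro Bochner_Integration.integral_diff Bochner_Integration.integrable_sum Bochner_Integration.integrable_add) auto
        also have "(\<integral>x. (\<Sum>j<m. s / (1 - s) * (v (x(j := x j / s)) - v x) + indicator {s<..} (x j)) \<partial>cubeM {..<m}) =
            (\<Sum>j<m. \<integral>x. s / (1 - s) * (v (x(j := x j / s)) - v x) + indicator {s<..} (x j) \<partial>cubeM {..<m})"
          using slab i1 by (intro Bochner_Integration.integral_sum Bochner_Integration.integrable_add) auto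
        also have "\<dots> = (\<Sum>j<m. s / (1 - s) * ((\<integral>x. v (x(j := x j / s)) \<partial>cubeM {..<m}) - I) +
            (\<integral>x. indicator {s<..} (x j) \<partial>cubeM {..<m}))"
        proof (rule sum.cong[OF refl])
          fix j assume "j \<in> {..<m}"
          then have "(\<integral>x. s / (1 - s) * (v (x(j := x j / s)) - v x) + indicator {s<..} (x j) \<partial>cubeM {..<m}) =
            (\<integral>x. s / (1 - s) * (v (x(j := x j / s)) - v x) \<partial>cubeM {..<m}) + (\<integral>x. indicator {s<..} (x j) \<partial>cubeM {..<m})"
            using slab i1 by (intro Bochner_Integration.integral_add) auto
          also have "(\<integral>x. s / (1 - s) * (v (x(j := x j / s)) - v x) \<partial>cubeM {..<m}) =
            s / (1 - s) * ((\<integral>x. v (x(j := x j / s)) \<partial>cubeM {..<m}) - I)"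
            unfolding I_def by (simp only: integral_mult_right_zero Bochner_Integration.integral_diff[OF int1[OF s(1)] intv])
          finally show "(\<integral>x. s / (1 - s) * (v (x(j := x j / s)) - v x) + indicator {s<..} (x j) \<partial>cubeM {..<m}) =
            s / (1 - s) * ((\<integral>x. v (x(j := x j / s)) \<partial>cubeM {..<m}) - I) + (\<integral>x. indicator {s<..} (x j) \<partial>cubeM {..<m})" .
        qed
        finally show ?thesis .
      qed
      also have "\<dots> = (\<Sum>j<m. s / (1 - s) * ((s * I + (1 - s) * F j) - I) + (1 - s)) - I"
      proof -
        have "(\<integral>x. v (x(j := x j / s)) \<partial>cubeM {..<m}) = s * I + (1 - s) * F j" if "j < m" for j
          unfolding I_def F_def by (rule integral_coordinate_stretch[OF v that s const])
        then show ?thesis using integral_cubeM_slab(2)[OF _ s] by (simp cong: sum.cong_simp)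
      qed
      finally show ?thesis .
    qed
    also have "\<dots> = (\<Sum>j<m. s * (F j - I) + (1 - s)) - I"
    proof -
      have "s / (1 - s) * ((s * I + (1 - s) * F j) - I) = s * (F j - I)" for j
      proof -
        have "(s * I + (1 - s) * F j) - I = (1 - s) * (F j - I)" by (simp add: algebra_simps)
        then show ?thesis using s by simp
      qed
      then show ?thesis by simp
    qed
    finally show ?thesis .
  qed
  have lower: "(\<Sum>j<m. (F j - (1 - s) - I) / s) - I \<le> integral\<^sup>L (completion (cubeM {..<m})) p"
    if s: "0 < s" "s < 1" for s
  proof -
    \<comment> \<open>Scaling down by \<open>s\<close> stays inside the cube, so no slab term
      appears; the move has length \<open>(1 - s) * x j\<close>.\<close>
    define H where "H x = (\<Sum>j<m. (v x - v (x(j := s * x j))) / (1 - s)) - v x" for x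
    have intH: "integrable (cubeM {..<m}) H"
      unfolding H_def using int2 intv
      by (intro Bochner_Integration.integrable_diff Bochner_Integration.integrable_sum integrable_divide) auto
    have "(\<Sum>j<m. (F j - (1 - s) - I) / s) - I \<le> (\<Sum>j<m. (I - (\<integral>x. v (x(j := s * x j)) \<partial>cubeM {..<m})) / (1 - s)) - I"
    proof (intro diff_right_mono sum_mono)
      fix j assume "j \<in> {..<m}"
      then have j: "j < m" by simp
      have "(\<integral>x. v (x(j := s * x j)) \<partial>cubeM {..<m}) \<le> (I - (1 - s) * (F j - (1 - s))) / s"
        unfolding I_def F_def using lip[OF j] by (intro integral_coordinate_shrink[OF v j s]) auto
      then have "(I - (I - (1 - s) * (F j - (1 - s))) / s) / (1 - s) \<le> (I - (\<integral>x. v (x(j := s * x j)) \<partial>cubeM {..<m})) / (1 - s)"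
        using s by (intro divide_right_mono) auto
      moreover have "(I - (I - (1 - s) * (F j - (1 - s))) / s) / (1 - s) = (F j - (1 - s) - I) / s"
      proof -
        have "I - (I - (1 - s) * (F j - (1 - s))) / s = (1 - s) * ((F j - (1 - s) - I) / s)"
          using s by (simp add: field_simps)
        then show ?thesis using s by simp
      qed
      ultimately show "(F j - (1 - s) - I) / s \<le> (I - (\<integral>x. v (x(j := s * x j)) \<partial>cubeM {..<m})) / (1 - s)" by simp
    qed
    also have "\<dots> = integral\<^sup>L (cubeM {..<m}) H"
      unfolding H_def I_def using int2 intv by simp
    also have "\<dots> = integral\<^sup>L (completion (cubeM {..<m})) H"
      using intH by (intro integral_completion[symmetric]) (auto intro: borel_measurable_integrable)
    also have "\<dots> \<le> integral\<^sup>L (completion (cubeM {..<m})) p"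
    proof (rule integral_mono[OF _ intp])
      show "integrable (completion (cubeM {..<m})) H"
        using intH by (subst integrable_completion) (auto intro: borel_measurable_integrable)
      fix x assume "x \<in> space (completion (cubeM {..<m}))"
      then have x: "x \<in> cube m" by (simp add: sp)
      have "(v x - v (x(j := s * x j))) / (1 - s) \<le> a x j * x j" if j: "j < m" for j
      proof -
        have xs: "0 \<le> s * x j" "s * x j \<le> 1" using s x01[OF x j] by (auto simp: mult_le_one)
        have "a x j * (s * x j - x j) \<le> v (x(j := s * x j)) - v x"
          using utility_upd_diff(2)[OF IC x j xs] vc[OF x] vc[OF cube_upd[OF x j xs]] by simp
        then have "v x - v (x(j := s * x j)) \<le> a x j * x j * (1 - s)" by (simp add: algebra_simps)
        then show ?thesis using s by (simp add: pos_divide_le_eq)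
      qed
      then show "H x \<le> p x" unfolding p_eq[OF x] H_def by (intro diff_right_mono sum_mono) auto
    qed
    finally show ?thesis .
  qed
  have "((\<lambda>s. (\<Sum>j<m. s * (F j - I) + (1 - s)) - I) \<longlongrightarrow> (\<Sum>j<m. 1 * (F j - I) + (1 - 1)) - I) (at_left 1)"
    by (intro tendsto_intros)
  from le_if_le_near_1[OF this upper]
  have 1: "integral\<^sup>L (completion (cubeM {..<m})) p \<le> (\<Sum>j<m. F j - I) - I" by simp
  \<comment> \<open>Negation brings the lower bound into the form of \<open>le_if_le_near_1\<close>,
    which bounds a limit from below.\<close>
  have "((\<lambda>s. - ((\<Sum>j<m. (F j - (1 - s) - I) / s) - I)) \<longlongrightarrow> - ((\<Sum>j<m. (F j - (1 - 1) - I) / 1) - I)) (at_left (1::real))"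
    by (intro tendsto_intros) auto
  from le_if_le_near_1[OF this le_imp_neg_le[OF lower]]
  have 2: "(\<Sum>j<m. F j - I) - I \<le> integral\<^sup>L (completion (cubeM {..<m})) p" by simp
  from 1 2 have "revenue m p = (\<Sum>j<m. F j - I) - I" by (simp add: revenue_def unifM_def)
  also have "\<dots> = (\<Sum>j<m. F j) - (real m + 1) * I" by (simp add: sum_subtractf algebra_simps)
  finally show ?thesis by (simp add: F_def I_def)
qed

section \<open>Optimality\<close>

text \<open>Serves the payments of SJA, which tie-breaking leaves open on a null set: the completion
  contains every set that agrees almost everywhere with a measurable one.\<close>

lemma borel_measurable_completion_AE:
  fixes f g :: "'a \<Rightarrow> 'b::topological_space"
  assumes g: "g \<in> borel_measurable M" and eq: "AE x in M. f x = g x"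
  shows "f \<in> borel_measurable (completion M)"
proof (rule measurableI)
  fix A :: "'b set" assume A: "A \<in> sets borel"
  have "AE x in completion M. f x = g x" using eq by (rule AE_completion)
  then have "AE x in completion M. (x \<in> g -` A \<inter> space M) = (x \<in> f -` A \<inter> space M)"
    by eventually_elim auto
  moreover have "g -` A \<inter> space M \<in> sets (completion M)"
    using measurable_sets[OF g A] by simp
  ultimately show "f -` A \<inter> space (completion M) \<in> sets (completion M)"
    using complete_measure.in_sets_AE[OF completion.complete_measure_axioms, of "g -` A \<inter> space M" "f -` A \<inter> space M"]
    by simp
qed simp

lemma sja_utility:
  assumes "sja_implements m p a pay" and x: "x \<in> cube m"
  shows "\<exists>J\<subseteq>{..<m}. utility m a pay x = (\<Sum>j\<in>J. x j) - p (card J) \<and> pay x = p (card J) \<and>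
      (\<forall>i<m. a x i = (if i \<in> J then 1 else 0))"
    and "L \<subseteq> {..<m} \<Longrightarrow> (\<Sum>j\<in>L. x j) - p (card L) \<le> utility m a pay x"
proof -
  obtain J where J: "J \<subseteq> {..<m}"
    "\<And>L. L \<subseteq> {..<m} \<Longrightarrow> (\<Sum>j\<in>L. x j) - p (card L) \<le> (\<Sum>j\<in>J. x j) - p (card J)"
    "\<forall>i<m. a x i = (if i \<in> J then 1 else 0)" "pay x = p (card J)"
    using assms by (auto simp: sja_implements_def)
  have "dotp m (a x) x = (\<Sum>i<m. if i \<in> J then x i else 0)"
    unfolding dotp_def using J(3) by (intro sum.cong) auto
  also have "\<dots> = (\<Sum>i\<in>J. x i)" using J(1) by (simp add: sum.inter_restrict[symmetric] Int_absorb1)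
  finally have u: "utility m a pay x = (\<Sum>j\<in>J. x j) - p (card J)" using J(4) by (simp add: utility_def)
  then show "\<exists>J\<subseteq>{..<m}. utility m a pay x = (\<Sum>j\<in>J. x j) - p (card J) \<and> pay x = p (card J) \<and>
      (\<forall>i<m. a x i = (if i \<in> J then 1 else 0))"
    using J by blast
  show "(\<Sum>j\<in>L. x j) - p (card L) \<le> utility m a pay x" if "L \<subseteq> {..<m}" using J(2)[OF that] u by simp
qed

text \<open>The buyer chooses from a fixed menu: another report only leads to another bundle at its
  menu price, and the empty bundle at price 0 guarantees nonnegative utility.\<close>

lemma sja_is_mechanism:
  assumes sja: "sja_implements m p a pay" and p0: "p 0 = 0"
  shows "is_alloc m a" "is_IC m a pay" "is_IR m a pay"
proof -
  show "is_alloc m a" unfolding is_alloc_def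
  proof (intro ballI allI impI)
    fix x i assume "x \<in> cube m" "i < m"
    with sja_utility(1)[OF sja, of x] show "0 \<le> a x i \<and> a x i \<le> 1" by auto
  qed
  show "is_IC m a pay" unfolding is_IC_def
  proof (intro ballI)
    fix x y assume x: "x \<in> cube m" and y: "y \<in> cube m"
    obtain J where J: "J \<subseteq> {..<m}" "pay y = p (card J)" "\<forall>i<m. a y i = (if i \<in> J then 1 else 0)"
      using sja_utility(1)[OF sja y] by blast
    have "dotp m (a y) x = (\<Sum>i<m. if i \<in> J then x i else 0)"
      unfolding dotp_def using J(3) by (intro sum.cong) auto
    also have "\<dots> = (\<Sum>i\<in>J. x i)" using J(1) by (simp add: sum.inter_restrict[symmetric] Int_absorb1)
    finally show "dotp m (a y) x - pay y \<le> dotp m (a x) x - pay x"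
      using sja_utility(2)[OF sja x J(1)] J(2) by (simp add: utility_def)
  qed
  show "is_IR m a pay" unfolding is_IR_def
  proof
    fix x assume "x \<in> cube m"
    from sja_utility(2)[OF sja this, of "{}"] show "0 \<le> dotp m (a x) x - pay x"
      by (simp add: utility_def p0)
  qed
qed

text \<open>Off the null set of ties the best bundle is unique, so every tie-breaking rule charges
  \<open>q\<close>, a finite combination of indicators of closed sets.\<close>

lemma sja_payment_measurable:
  assumes sja: "sja_implements m p a pay"
  shows "pay \<in> borel_measurable (completion (unifM m))"
proof -
  define V where "V J = (\<Inter>L\<in>Pow {..<m}. {x::nat \<Rightarrow> real. (\<Sum>j\<in>L. x j) - p (card L) \<le> (\<Sum>j\<in>J. x j) - p (card J)})" for J
  define q where "q x = (\<Sum>J\<in>Pow {..<m}. indicator (V J) x * p (card J))" for x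
  have V: "V J \<in> sets borel" for J
    unfolding V_def
    by (intro borel_closed closed_INT ballI closed_Collect_le continuous_intros continuous_on_product_coordinates)
  have "q \<in> borel_measurable borel"
    unfolding q_def using V by measurable
  then have "q \<in> borel_measurable (cubeM {..<m})"
    using measurable_compose[OF measurable_cubeM_borel] by blast
  moreover have "AE x in cubeM {..<m}. pay x = q x"
    using AE_no_tie[of m "\<lambda>J L. p (card J) - p (card L)"] AE_space
  proof eventually_elim
    case (elim x)
    then have x: "x \<in> cube m" by (simp add: space_cubeM cube_def)
    obtain J where J: "J \<subseteq> {..<m}" "utility m a pay x = (\<Sum>j\<in>J. x j) - p (card J)" "pay x = p (card J)"
      using sja_utility(1)[OF sja x] by blast
    have VJ: "x \<in> V J" using sja_utility(2)[OF sja x] J(2) by (auto simp: V_def)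
    have uniq: "L = J" if "L \<subseteq> {..<m}" "x \<in> V L" for L
    proof (rule ccontr)
      assume "L \<noteq> J"
      have "(\<Sum>k\<in>L. x k) - (\<Sum>k\<in>J. x k) = p (card L) - p (card J)"
        using that VJ J(1) unfolding V_def by (smt (verit) INT_D PowI mem_Collect_eq)
      with elim(1) \<open>L \<noteq> J\<close> that(1) J(1) show False by blast
    qed
    have "q x = (\<Sum>L\<in>Pow {..<m}. if L = J then p (card J) else 0)"
      unfolding q_def
    proof (rule sum.cong[OF refl])
      fix L assume "L \<in> Pow {..<m}"
      then have "x \<in> V L \<longleftrightarrow> L = J" using uniq VJ by blast
      then show "indicator (V L) x * p (card L) = (if L = J then p (card J) else 0)"
        by (simp add: indicator_def)
    qed
    also have "\<dots> = p (card J)" using J(1) by simp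
    finally show ?case using J(3) by simp
  qed
  ultimately show ?thesis unfolding unifM_def by (rule borel_measurable_completion_AE)
qed

text \<open>Regions use normalized prices and the mechanism the original ones, but the maximal
  surplus is the same. Thus on the region of \<open>J\<close> the utility has slope 1 in every
  coordinate of \<open>J\<close>.\<close>

lemma sja_region_utility:
  assumes sja: "sja_implements m p a pay" and x: "x \<in> sja_region m p J" and J: "J \<subseteq> {..<m}"
  shows "utility m a pay x = (\<Sum>j\<in>J. x j) - norm_prices m p (card J)"
proof (rule antisym)
  have xc: "x \<in> cube m" using x by (simp add: sja_region_def)
  obtain K where K: "K \<subseteq> {..<m}" "utility m a pay x = (\<Sum>j\<in>K. x j) - p (card K)"
    using sja_utility(1)[OF sja xc] by blast
  have "(\<Sum>j\<in>K. x j) - norm_prices m p (card K) \<le> (\<Sum>j\<in>J. x j) - norm_prices m p (card J)"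
    using x K(1) by (simp add: sja_region_def)
  with norm_prices_cases(1)[OF K(1) xc, of p] K(2)
  show "utility m a pay x \<le> (\<Sum>j\<in>J. x j) - norm_prices m p (card J)" by simp
  show "(\<Sum>j\<in>J. x j) - norm_prices m p (card J) \<le> utility m a pay x"
    using norm_prices_cases(2)[OF J xc, of p] sja_utility(2)[OF sja xc J]
      sja_utility(2)[OF sja xc, of "{..<m}"] by auto
qed

lemma sja_revenue_maximal:
  assumes m: "m \<ge> 1" and prices: "sja_prices m p"
    and nodef: "\<And>J A. J \<subseteq> {..<m} \<Longrightarrow> J \<noteq> {} \<Longrightarrow> sja_region m p J \<noteq> {} \<Longrightarrow> body (card J) A \<Longrightarrow>
       A \<subseteq> SIM_body (card J) (sja_lambda m p) \<Longrightarrow> deficiency 1 (card J) A \<le> 0"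
    and sja: "sja_implements m p a pay"
    and mech: "is_alloc m b" "is_IC m b q" "is_IR m b q" "q \<in> borel_measurable (completion (unifM m))"
  shows "revenue m q \<le> revenue m pay"
proof -
  have p0: "p 0 = 0" using prices by (simp add: sja_prices_def)
  note sm = sja_is_mechanism[OF sja p0]
  define N where "N = real m + 1"
  define u where "u x = utility m b q (clip m x)" for x
  define us where "us x = utility m a pay (clip m x)" for x
  define one where "one = (\<lambda>i\<in>{..<m}. 1::real)"
  \<comment> \<open>The competitor's utility is largest at the top corner, so adding this value
    makes \<open>g\<close> nonnegative, as the integration over levels requires.\<close>
  define C where "C = u one"
  define g where "g x = us x - u x + C" for x
  define Z where "Z = {x \<in> space (cubeM {..<m}). \<forall>J. J \<subseteq> {..<m} \<and> J \<noteq> {} \<longrightarrow> (\<Sum>j\<in>J. x j) < p (card J)}"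
  define I where "I f = integral\<^sup>L (cubeM {..<m}) f" for f :: "(nat \<Rightarrow> real) \<Rightarrow> real"
  define F where "F j f = (\<integral>x. f (x(j := 1)) \<partial>cubeM ({..<m} - {j}))" for j and f :: "(nat \<Rightarrow> real) \<Rightarrow> real"
  interpret M: prob_space "cubeM {..<m}" by (rule prob_space_cubeM) simp
  have Mj: "prob_space (cubeM ({..<m} - {j}))" for j by (rule prob_space_cubeM) simp
  have sp: "space (cubeM {..<m}) = cube m" by (simp add: space_cubeM cube_def)
  have cu: "continuous_on UNIV u" unfolding u_def by (rule continuous_utility_clip[OF mech(2,1)])
  have cus: "continuous_on UNIV us" unfolding us_def by (rule continuous_utility_clip[OF sm(2,1)])
  have cg: "continuous_on UNIV g" unfolding g_def by (intro continuous_intros cu cus)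
  have one: "one \<in> cube m" by (auto simp: one_def cube_def)
  have u0: "0 \<le> u x" and us0: "0 \<le> us x" for x
    using mech(3) sm(3) by (auto simp: u_def us_def utility_def is_IR_def)
  have uC: "u x \<le> C" for x
  proof -
    define y where "y = clip m x"
    have y: "y \<in> cube m" by (simp add: y_def)
    have "utility m b q y - utility m b q one \<le> (\<Sum>i<m. b y i * (y i - one i))"
      by (rule utility_diff_le[OF mech(2) one y])
    also have "\<dots> \<le> 0"
    proof (rule sum_nonpos)
      fix i assume "i \<in> {..<m}"
      then have "0 \<le> b y i" "y i \<le> 1" "one i = 1"
        using mech(1) y by (auto simp: is_alloc_def one_def cube_def PiE_def Pi_def)
      then show "b y i * (y i - one i) \<le> 0" by (simp add: mult_nonneg_nonpos)
    qed
    finally show ?thesis by (simp add: u_def C_def y_def clip_id[OF one])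
  qed
  have g0: "0 \<le> g x" for x using us0[of x] uC[of x] by (simp add: g_def)
  \<comment> \<open>Raising \<open>x j\<close> to 1 gains exactly \<open>1 - x j\<close> under SJA
    and at most that under the competitor.\<close>
  have up: "g x \<le> g (x(j := 1))" if J: "J \<subseteq> {..<m}" and x: "x \<in> sja_region m p J" and j: "j \<in> J" for J x j
  proof -
    have xc: "x \<in> cube m" using x by (simp add: sja_region_def)
    have jm: "j < m" using j J by auto
    have x1: "x(j := 1) \<in> sja_region m p J" by (rule sja_region_upd[OF x J j])
    have x1c: "x(j := 1) \<in> cube m" using x1 by (simp add: sja_region_def)
    have fin: "finite J" using J finite_subset by blast
    have "utility m b q (x(j := 1)) - utility m b q x \<le> b (x(j := 1)) j * (1 - x j)"
      using utility_upd_diff(1)[OF mech(2) xc jm, of 1] by simp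
    also have "\<dots> \<le> 1 * (1 - x j)"
      using mech(1) x1c xc jm by (intro mult_right_mono) (auto simp: is_alloc_def cube_def PiE_def Pi_def)
    finally have "utility m b q (x(j := 1)) - utility m b q x \<le> 1 - x j" by simp
    moreover have "utility m a pay (x(j := 1)) - utility m a pay x = 1 - x j"
      unfolding sja_region_utility[OF sja x J] sja_region_utility[OF sja x1 J] sum_fun_upd[OF fin]
      using j by simp
    ultimately show ?thesis
      by (simp add: g_def u_def us_def clip_id[OF xc] clip_id[OF x1c])
  qed
  have Zcompl: "\<exists>J. J \<subseteq> {..<m} \<and> J \<noteq> {} \<and> p (card J) \<le> (\<Sum>j\<in>J. x j)" if "x \<in> cube m" "x \<notin> Z" for x
    using that by (auto simp: Z_def sp not_less)
  have Zset: "Z \<in> sets (cubeM {..<m})"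
  proof -
    have "{x::nat \<Rightarrow> real. \<forall>J. J \<subseteq> {..<m} \<and> J \<noteq> {} \<longrightarrow> (\<Sum>j\<in>J. x j) < p (card J)} =
        (\<Inter>J\<in>Pow {..<m} - {{}}. {x. (\<Sum>j\<in>J. x j) < p (card J)})" by auto
    also have "open \<dots>"
      by (intro open_INT ballI open_Collect_less continuous_intros continuous_on_product_coordinates) auto
    finally have "{x::nat \<Rightarrow> real. \<forall>J. J \<subseteq> {..<m} \<and> J \<noteq> {} \<longrightarrow> (\<Sum>j\<in>J. x j) < p (card J)} \<in> sets borel"
      by (rule borel_open)
    from measurable_sets[OF measurable_cubeM_borel this, of "{..<m}"] show ?thesis
      by (simp add: Z_def Int_def vimage_def conj_commute)
  qed
  \<comment> \<open>The price condition at \<open>r = m\<close>. The value is \<open>1 / N\<close>,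
    so the complement of \<open>Z\<close> has mass \<open>m / N\<close>.\<close>
  have Zprob: "measure (cubeM {..<m}) Z = 1 - real m / N"
    using prices m by (auto simp: sja_prices_def sja_prob_def unifM_def Z_def N_def)
  have int: "integrable (cubeM {..<m}) u" "integrable (cubeM {..<m}) us"
    using cu cus by (auto intro: integrable_cubeM)
  define ind where "ind x = (indicator (- Z) x :: real)" for x
  have indm: "ind \<in> borel_measurable (cubeM {..<m})"
  proof -
    have "(\<lambda>x. 1 - indicator Z x :: real) \<in> borel_measurable (cubeM {..<m})" using Zset by measurable
    moreover have "ind = (\<lambda>x. 1 - indicator Z x)" by (auto simp: ind_def indicator_def)
    ultimately show ?thesis by simp
  qed
  have intind: "integrable (cubeM {..<m}) (\<lambda>x. ind x * f x)" if "integrable (cubeM {..<m}) f" for f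
  proof (rule Bochner_Integration.integrable_bound[OF that])
    show "(\<lambda>x. ind x * f x) \<in> borel_measurable (cubeM {..<m})"
      using indm borel_measurable_integrable[OF that] by (rule borel_measurable_times)
  qed (auto simp: ind_def indicator_def)
  have gI: "integrable (cubeM {..<m}) g" using cg by (auto intro: integrable_cubeM)
  have cupd: "continuous_on UNIV (\<lambda>x. f (x(j := 1)))" if "continuous_on UNIV f" for f :: "(nat \<Rightarrow> real) \<Rightarrow> real" and j
    by (intro continuous_on_compose2[OF that continuous_on_fun_upd]) auto
  have intF: "integrable (cubeM ({..<m} - {j})) (\<lambda>x. f (x(j := 1)))" if "continuous_on UNIV f" for f :: "(nat \<Rightarrow> real) \<Rightarrow> real" and j
    using cupd[OF that] by (intro integrable_cubeM) auto
  have "ennreal N * (\<integral>\<^sup>+ x. ennreal (ind x * g x) \<partial>cubeM {..<m}) \<le>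
      (\<Sum>j<m. \<integral>\<^sup>+ x. ennreal (g (x(j := 1))) \<partial>cubeM ({..<m} - {j}))"
    unfolding N_def ind_def by (rule sja_face_bound[OF m p0 nodef cg g0 up Zcompl])
  also have "\<dots> = (\<Sum>j<m. ennreal (F j g))"
    unfolding F_def using intF[OF cg] g0 by (intro sum.cong refl nn_integral_eq_integral) auto
  also have "\<dots> = ennreal (\<Sum>j<m. F j g)"
    unfolding F_def using g0 by (intro sum_ennreal) (auto intro!: integral_nonneg)
  also have "(\<integral>\<^sup>+ x. ennreal (ind x * g x) \<partial>cubeM {..<m}) = ennreal (I (\<lambda>x. ind x * g x))"
    unfolding I_def using intind[OF gI] g0 by (intro nn_integral_eq_integral) (auto simp: ind_def)
  finally have "ennreal (N * I (\<lambda>x. ind x * g x)) \<le> ennreal (\<Sum>j<m. F j g)"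
    by (simp add: ennreal_mult' N_def)
  then have bound: "N * I (\<lambda>x. ind x * g x) \<le> (\<Sum>j<m. F j g)"
    using g0 by (subst (asm) ennreal_le_iff) (auto simp: F_def intro!: sum_nonneg integral_nonneg)
  have Fg: "F j g = F j us - F j u + C" for j
    unfolding F_def g_def using intF[OF cus, of j] intF[OF cu, of j] prob_space.prob_space[OF Mj[of j]]
    by (simp add: finite_measure.integrable_const[OF prob_space.finite_measure[OF Mj[of j]]])
  \<comment> \<open>After multiplication by \<open>N\<close> the constant contributes
    \<open>C * m\<close>, exactly what it contributes on the \<open>m\<close> faces in
    \<open>Fg\<close>, so it will cancel.\<close>
  have "I (\<lambda>x. ind x * g x) = I (\<lambda>x. ind x * (us x - u x)) + C * (real m / N)"
  proof -
    have "I ind = real m / N"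
    proof -
      have "I ind = I (\<lambda>x. 1 - indicator Z x)" by (auto simp: ind_def indicator_def I_def intro!: Bochner_Integration.integral_cong)
      also have "\<dots> = 1 - measure (cubeM {..<m}) Z"
        unfolding I_def using Zset by (simp add: M.prob_space M.emeasure_eq_measure)
      finally show ?thesis by (simp add: Zprob)
    qed
    moreover have "I (\<lambda>x. ind x * g x) = I (\<lambda>x. ind x * (us x - u x)) + I (\<lambda>x. ind x * C)"
      unfolding I_def g_def distrib_left using int intind[of "\<lambda>x. us x - u x"] intind[of "\<lambda>x. C"]
      by (intro Bochner_Integration.integral_add) auto
    ultimately show ?thesis by (simp add: I_def mult.commute)
  qed
  \<comment> \<open>On \<open>Z\<close> every nonempty bundle has negative surplus, so
    \<open>us\<close> is at most 0 while \<open>u\<close> is at least 0; discarding \<open>Z\<close>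
    cannot decrease the integral of the difference.\<close>
  moreover have "I (\<lambda>x. us x - u x) \<le> I (\<lambda>x. ind x * (us x - u x))"
    unfolding I_def
  proof (rule integral_mono)
    fix x assume "x \<in> space (cubeM {..<m})"
    then have xc: "x \<in> cube m" by (simp add: sp)
    show "us x - u x \<le> ind x * (us x - u x)"
    proof (cases "x \<in> Z")
      case True
      obtain J where J: "J \<subseteq> {..<m}" "utility m a pay x = (\<Sum>j\<in>J. x j) - p (card J)"
        using sja_utility(1)[OF sja xc] by blast
      have "utility m a pay x \<le> 0"
      proof (cases "J = {}")
        case False
        then have "(\<Sum>j\<in>J. x j) < p (card J)" using True J(1) by (simp add: Z_def)
        then show ?thesis using J(2) by simp
      qed (use J p0 in simp)
      then show ?thesis using True u0[of x] by (simp add: ind_def us_def clip_id[OF xc])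
    qed (simp add: ind_def)
  qed (use int intind[of "\<lambda>x. us x - u x"] in auto)
  moreover have "I (\<lambda>x. us x - u x) = I us - I u" unfolding I_def using int by simp
  ultimately have "N * (I us - I u) + C * real m \<le> (\<Sum>j<m. F j us - F j u + C)"
  proof -
    assume 1: "I (\<lambda>x. ind x * g x) = I (\<lambda>x. ind x * (us x - u x)) + C * (real m / N)"
      and 2: "I (\<lambda>x. us x - u x) \<le> I (\<lambda>x. ind x * (us x - u x))" and 3: "I (\<lambda>x. us x - u x) = I us - I u"
    have N: "N > 0" by (simp add: N_def)
    have "N * (I us - I u) + C * real m = N * (I us - I u + C * (real m / N))"
      using N by (simp add: field_simps)
    also have "\<dots> \<le> N * I (\<lambda>x. ind x * g x)" using 1 2 3 N by (intro mult_left_mono) auto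
    also have "\<dots> \<le> (\<Sum>j<m. F j g)" by (rule bound)
    finally show ?thesis by (simp add: Fg)
  qed
  \<comment> \<open>With \<open>C\<close> cancelled, the two sides are the revenue functionals of
    the competitor and of SJA.\<close>
  then have "(\<Sum>j<m. F j u) - N * I u \<le> (\<Sum>j<m. F j us) - N * I us"
    by (simp add: sum.distrib sum_subtractf algebra_simps)
  moreover have "revenue m q = (\<Sum>j<m. F j u) - N * I u"
    unfolding F_def I_def N_def u_def by (rule revenue_formula[OF mech(1,2,4)])
  moreover have "revenue m pay = (\<Sum>j<m. F j us) - N * I us"
    unfolding F_def I_def N_def us_def by (rule revenue_formula[OF sm(1,2) sja_payment_measurable[OF sja]])
  ultimately show ?thesis by simp
qed

theorem theorem4:
  fixes m :: nat and p :: "nat \<Rightarrow> real"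
    and a :: "(nat \<Rightarrow> real) \<Rightarrow> (nat \<Rightarrow> real)" and pay :: "(nat \<Rightarrow> real) \<Rightarrow> real"
  assumes "m \<ge> 1"
    and "sja_prices m p"
    and "\<forall>J. J \<subseteq> {..<m} \<and> J \<noteq> {} \<and> sja_region m p J \<noteq> {} \<longrightarrow>
           \<not> (\<exists>A. body (card J) A \<and> A \<subseteq> SIM_body (card J) (sja_lambda m p)
                  \<and> deficiency 1 (card J) A > 0)"
    and "sja_implements m p a pay"
  shows "revenue m pay = opt_revenue m"
proof -
  have p0: "p 0 = 0" using assms(2) by (simp add: sja_prices_def)
  have nodef: "deficiency 1 (card J) A \<le> 0"
    if "J \<subseteq> {..<m}" "J \<noteq> {}" "sja_region m p J \<noteq> {}" "body (card J) A"
      "A \<subseteq> SIM_body (card J) (sja_lambda m p)" for J A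
    using assms(3) that by (meson not_less)
  show ?thesis
    unfolding opt_revenue_def
  proof (rule cSup_eq_maximum[symmetric])
    \<comment> \<open>SJA is itself one of the competing mechanisms, so the supremum is
      attained.\<close>
    show "revenue m pay \<in> {revenue m p | a p. is_alloc m a \<and> is_IC m a p \<and> is_IR m a p
       \<and> p \<in> borel_measurable (completion (unifM m))}"
      using sja_is_mechanism[OF assms(4) p0] sja_payment_measurable[OF assms(4)] by blast
    show "r \<le> revenue m pay" if "r \<in> {revenue m p | a p. is_alloc m a \<and> is_IC m a p \<and> is_IR m a p
       \<and> p \<in> borel_measurable (completion (unifM m))}" for r
      using that sja_revenue_maximal[OF assms(1,2) nodef assms(4)] by blast
  qed
qed

end
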